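(* Let $\ell\ge 2$ be an integer, and let $m$ be a positive integer such that $-m$ is not a pole of (the meromorphic continuation to $\mathbb{C}$ of) the $\ell$-generalized Fibonacci zeta function $\zeta_{F^{(\ell)}}(s)$. Then $\zeta_{F^{(\ell)}}(-m)\in\mathbb{Q}$.
   Context: For an integer $\ell\ge 2$, the $\ell$-generalized Fibonacci sequence $\left(F_n^{(\ell)}\right)_{n\ge 2-\ell}$ is defined by $F_{-(\ell-2)}^{(\ell)}=F_{-(\ell-3)}^{(\ell)}=\cdots=F_0^{(\ell)}=0$, $F_1^{(\ell)}=1$, and $F_n^{(\ell)}=F_{n-1}^{(\ell)}+F_{n-2}^{(\ell)}+\cdots+F_{n-\ell}^{(\ell)}$ for $n\ge 2$. The $\ell$-generalized Fibonacci zeta function is $\zeta_{F^{(\ell)}}(s)=\sum_{n=1}^{\infty}\left(F_n^{(\ell)}\right)^{-s}$, which converges absolutely for $\mathrm{Re}(s)>0$ and has a meromorphic continuation to all of $\mathbb{C}$, also denoted $\zeta_{F^{(\ell)}}(s)$. *)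

theory Defs
  imports "HOL-Complex_Analysis.Complex_Analysis"
begin

text \<open>
  The sequence is extended by zero to all integers below \<open>2 - \<ell>\<close>; the recurrence never
  reaches those indices.
\<close>

function gen_fib :: "nat \<Rightarrow> int \<Rightarrow> nat" where
  "gen_fib l n = (if n \<le> 0 then 0 else if n = 1 then 1 else (\<Sum>i = 1..l. gen_fib l (n - int i)))"
  by auto
termination by (relation "Wellfounded.measure (\<lambda>(l, n). nat n)") auto

declare gen_fib.simps [simp del]

definition gen_fib_zeta_series :: "nat \<Rightarrow> complex \<Rightarrow> complex" where
  "gen_fib_zeta_series l s = (\<Sum>n. of_nat (gen_fib l (int n + 1)) powr (-s))"

text \<open>
  \<open>nicely_meromorphic_on\<close> means that removable singularities are filled in and that the value
  at a pole is \<open>0\<close>. This makes the continuation unique as a total function, and its value at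
  a point that is not a pole is the analytic one.
\<close>

definition gen_fib_zeta :: "nat \<Rightarrow> complex \<Rightarrow> complex" where
  "gen_fib_zeta l = (THE Z. Z nicely_meromorphic_on UNIV \<and>
     (\<forall>s. Re s > 0 \<longrightarrow> Z s = gen_fib_zeta_series l s))"

end

theory Submission
  imports Defs "HOL-Computational_Algebra.Fundamental_Theorem_Algebra"
begin

text \<open>
  By Binet's formula \<open>F n = c \<alpha> ^ n (1 + \<epsilon> n)\<close>, where \<open>\<alpha> > 1\<close> is the dominant root of
  \<open>x ^ l - x ^ (l - 1) - \<dots> - 1\<close>, all other roots lie in the open unit disc, and \<open>\<epsilon> n\<close> is a sum of
  geometric sequences. Expanding \<open>(1 + \<epsilon> n) powr (- s)\<close> by the binomial series and summing over
  \<open>n\<close> continues the zeta function. At \<open>s = - m\<close> the binomial series terminates and the value is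
  the sum of the exponential polynomial \<open>F n ^ m\<close>, regularized term by term, provided that no
  product of \<open>m\<close> roots equals \<open>1\<close>; this regularized sum is rational, because the products of \<open>m\<close>
  roots are the zeros of a rational polynomial. Up to powers, the only multiplicative relation
  between the roots is that their product is \<open>1\<close> or \<open>- 1\<close>. Hence, if some product of \<open>m\<close> roots
  equals \<open>1\<close>, the singular terms at \<open>- m\<close> all have the same nonzero coefficient, they do not
  cancel, and \<open>- m\<close> is a pole.
\<close>

section \<open>Power sums and Newton's identities\<close>

text \<open>Logarithmic derivatives add up over a product, and that of \<open>1 - a X\<close> is the
  geometric series with terms \<open>- a ^ Suc n\<close>.\<close>

lemma fps_deriv_prod_linear:
  fixes f :: "'i \<Rightarrow> 'a::field"
  assumes "finite T"
  shows "fps_deriv (\<Prod>t\<in>T. 1 - fps_const (f t) * fps_X) =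
    - (\<Prod>t\<in>T. 1 - fps_const (f t) * fps_X) * Abs_fps (\<lambda>n. \<Sum>t\<in>T. f t ^ Suc n)"
  using assms
proof (induction T rule: finite_induct)
  case empty
  have "Abs_fps (\<lambda>n. 0) = (0 :: 'a fps)" by (simp add: fps_eq_iff)
  then show ?case by simp
next
  case (insert x T)
  define E where "E = (\<Prod>t\<in>T. 1 - fps_const (f t) * fps_X)"
  define S where "S = Abs_fps (\<lambda>n. \<Sum>t\<in>T. f t ^ Suc n)"
  define G where "G = Abs_fps (\<lambda>n. f x ^ Suc n)"
  define L where "L = 1 - fps_const (f x) * fps_X"
  have S': "Abs_fps (\<lambda>n. \<Sum>t\<in>insert x T. f t ^ Suc n) = G + S"
    using insert by (simp add: fps_eq_iff G_def S_def)
  have LG: "L * G = fps_const (f x)"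
  proof (rule fps_ext)
    fix n show "fps_nth (L * G) n = fps_nth (fps_const (f x)) n"
      by (cases n) (simp_all add: L_def G_def left_diff_distrib mult.assoc)
  qed
  have dL: "fps_deriv L = - fps_const (f x)" by (simp add: L_def)
  have "fps_deriv (L * E) = L * fps_deriv E + fps_deriv L * E" by simp
  also have "\<dots> = L * (- E * S) - L * G * E"
    using insert.IH by (simp add: E_def S_def dL LG flip: fps_const_neg)
  also have "\<dots> = - (L * E) * (G + S)" by (simp add: algebra_simps)
  finally show ?case using insert by (simp add: S'[symmetric] E_def L_def)
qed

text \<open>Compares the coefficients of \<open>X ^ n\<close> in the formula for the derivative of
  the product.\<close>

lemma newton_identity:
  fixes f :: "'i \<Rightarrow> 'a::field"
  assumes "finite T"
  shows "of_nat (Suc n) * coeff (\<Prod>t\<in>T. [:1, - f t:]) (Suc n) =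
    - (\<Sum>i\<le>n. coeff (\<Prod>t\<in>T. [:1, - f t:]) i * (\<Sum>t\<in>T. f t ^ (Suc n - i)))"
proof -
  have "fps_of_poly (\<Prod>t\<in>T. [:1, - f t:]) = (\<Prod>t\<in>T. 1 - fps_const (f t) * fps_X)"
    by (simp add: fps_of_poly_prod fps_of_poly_pCons mult.commute flip: fps_const_neg)
  then have c: "coeff (\<Prod>t\<in>T. [:1, - f t:]) k
      = fps_nth (\<Prod>t\<in>T. 1 - fps_const (f t) * fps_X) k" for k
    by (metis fps_of_poly_nth)
  have "of_nat (Suc n) * coeff (\<Prod>t\<in>T. [:1, - f t:]) (Suc n) =
    fps_nth (fps_deriv (\<Prod>t\<in>T. 1 - fps_const (f t) * fps_X)) n"
    by (simp add: c)
  also have "\<dots> = - (\<Sum>i\<le>n. coeff (\<Prod>t\<in>T. [:1, - f t:]) i * (\<Sum>t\<in>T. f t ^ (Suc n - i)))"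
    unfolding fps_deriv_prod_linear[OF assms]
    by (simp add: fps_mult_nth c sum_negf atLeast0AtMost Suc_diff_le)
  finally show ?thesis .
qed

lemma coeff_0_prod_linear: "coeff (\<Prod>t\<in>T. [:1, - f t:]) 0 = (1 :: 'a::field)"
  by (simp add: poly_prod flip: poly_0_coeff_0)

text \<open>Newton's identity is solved for the coefficient; characteristic zero allows the division
  by \<open>n\<close>.\<close>

lemma coeff_prod_linear_Rats:
  fixes f :: "'i \<Rightarrow> 'a::field_char_0"
  assumes "finite T" "\<And>n. (\<Sum>t\<in>T. f t ^ n) \<in> \<rat>"
  shows "coeff (\<Prod>t\<in>T. [:1, - f t:]) n \<in> \<rat>"
proof (induction n rule: less_induct)
  case (less n)
  show ?case
  proof (cases n)
    case 0
    then show ?thesis using coeff_0_prod_linear[of f T] by simp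
  next
    case (Suc k)
    have "of_nat n * coeff (\<Prod>t\<in>T. [:1, - f t:]) n \<in> \<rat>"
      unfolding Suc newton_identity[OF assms(1)] Rats_minus_iff
      by (rule Rats_sum, rule Rats_mult) (use less Suc assms(2) in auto)
    then have "of_nat n * coeff (\<Prod>t\<in>T. [:1, - f t:]) n / of_nat n \<in> \<rat>"
      by (intro Rats_divide) auto
    then show ?thesis using Suc by (simp del: of_nat_Suc)
  qed
qed

text \<open>Newton's identity is solved for the power sum, which is multiplied there by the constant
  coefficient \<open>1\<close>, so no denominators arise.\<close>

lemma power_sum_Ints:
  fixes f :: "'i \<Rightarrow> 'a::field"
  assumes "finite T" "\<And>n. coeff (\<Prod>t\<in>T. [:1, - f t:]) n \<in> \<int>"
  shows "(\<Sum>t\<in>T. f t ^ n) \<in> \<int>"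
proof (induction n rule: less_induct)
  case (less n)
  show ?case
  proof (cases n)
    case 0
    then show ?thesis by simp
  next
    case (Suc k)
    define E where "E = (\<Prod>t\<in>T. [:1, - f t:])"
    have "of_nat n * coeff E n = - (\<Sum>i\<le>k. coeff E i * (\<Sum>t\<in>T. f t ^ (n - i)))"
      using newton_identity[OF assms(1), of k f] by (simp add: E_def Suc)
    also have "{..k} = insert 0 {1..k}" by auto
    also have "(\<Sum>i\<in>insert 0 {1..k}. coeff E i * (\<Sum>t\<in>T. f t ^ (n - i))) =
       (\<Sum>t\<in>T. f t ^ n) + (\<Sum>i=1..k. coeff E i * (\<Sum>t\<in>T. f t ^ (n - i)))"
      by (simp add: E_def coeff_0_prod_linear)
    finally have "(\<Sum>t\<in>T. f t ^ n) =
      - (of_nat n * coeff E n) - (\<Sum>i=1..k. coeff E i * (\<Sum>t\<in>T. f t ^ (n - i)))"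
      by (simp only: minus_add_distrib) (simp add: algebra_simps)
    also have "\<dots> \<in> \<int>"
    proof (intro Ints_diff Ints_minus)
      show "of_nat n * coeff E n \<in> \<int>"
        using assms(2) by (auto simp: E_def intro: Ints_mult)
      show "(\<Sum>i=1..k. coeff E i * (\<Sum>t\<in>T. f t ^ (n - i))) \<in> \<int>"
        by (rule Ints_sum, rule Ints_mult) (use assms(2) less Suc in \<open>auto simp: E_def\<close>)
    qed
    finally show ?thesis .
  qed
qed

text \<open>The type carries the rationality of the coefficients, which later transfers zeros from
  one root to another.\<close>

definition rpoly :: "rat poly \<Rightarrow> complex \<Rightarrow> complex" where
  "rpoly p t = poly (map_poly of_rat p) t"

lemma rpoly_0 [simp]: "rpoly 0 t = 0"
  by (simp add: rpoly_def)

lemma rpoly_pCons [simp]: "rpoly (pCons a p) t = of_rat a + t * rpoly p t"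
  by (simp add: rpoly_def map_poly_pCons)

lemma rpoly_add [simp]: "rpoly (p + q) t = rpoly p t + rpoly q t"
  by (induction p q rule: poly_induct2) (simp_all add: of_rat_add algebra_simps)

lemma rpoly_smult [simp]: "rpoly (smult a p) t = of_rat a * rpoly p t"
  by (induction p) (simp_all add: of_rat_mult algebra_simps)

lemma rpoly_minus [simp]: "rpoly (- p) t = - rpoly p t"
  using rpoly_smult[of "-1" p t] by (simp add: of_rat_minus)

lemma rpoly_diff [simp]: "rpoly (p - q) t = rpoly p t - rpoly q t"
  using rpoly_add[of p "smult (-1) q" t] rpoly_smult[of "-1" q t] by (simp add: of_rat_minus)

lemma rpoly_mult [simp]: "rpoly (p * q) t = rpoly p t * rpoly q t"
  by (induction p) (simp_all add: algebra_simps)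

lemma rpoly_1 [simp]: "rpoly 1 t = 1"
  by (simp add: one_pCons)

lemma rpoly_sum [simp]: "rpoly (\<Sum>i\<in>A. p i) t = (\<Sum>i\<in>A. rpoly (p i) t)"
  by (induction A rule: infinite_finite_induct) simp_all

lemma rpoly_prod [simp]: "rpoly (\<Prod>i\<in>A. p i) t = (\<Prod>i\<in>A. rpoly (p i) t)"
  by (induction A rule: infinite_finite_induct) simp_all

lemma rpoly_monom [simp]: "rpoly (monom a n) t = of_rat a * t ^ n"
  by (induction n) (simp_all add: monom_Suc monom_0)

text \<open>
  By Newton's identities, the coefficients of a product of linear factors depend on its power sums
  through formulas that do not involve the factors.
\<close>

fun newton_coeff :: "(nat \<Rightarrow> rat poly) \<Rightarrow> nat \<Rightarrow> rat poly" where
  "newton_coeff S 0 = 1"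
| "newton_coeff S (Suc n) =
    smult (- 1 / of_nat (Suc n)) (\<Sum>i\<le>n. newton_coeff S i * S (Suc n - i))"

lemma coeff_prod_linear_eq_newton_coeff:
  assumes "finite T" "\<And>n. (\<Sum>\<tau>\<in>T. f \<tau> ^ n) = rpoly (S n) t"
  shows "coeff (\<Prod>\<tau>\<in>T. [:1, - f \<tau>:]) n = rpoly (newton_coeff S n) t"
proof (induction n rule: less_induct)
  case (less n)
  show ?case
  proof (cases n)
    case 0
    then show ?thesis using coeff_0_prod_linear[of f T] by simp
  next
    case (Suc k)
    define E where "E = (\<Prod>\<tau>\<in>T. [:1, - f \<tau>:])"
    have "of_nat n * coeff E n = - (\<Sum>i\<le>k. coeff E i * (\<Sum>t\<in>T. f t ^ (n - i)))"
      using newton_identity[OF assms(1), of k f] by (simp add: E_def Suc)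
    also have "\<dots> = - (\<Sum>i\<le>k. rpoly (newton_coeff S i) t * rpoly (S (n - i)) t)"
      using less Suc by (intro arg_cong[of _ _ uminus] sum.cong) (auto simp: E_def assms(2))
    finally have "coeff E n = - (\<Sum>i\<le>k. rpoly (newton_coeff S i) t * rpoly (S (n - i)) t) / of_nat n"
      using Suc by (simp add: field_simps del: of_nat_Suc)
    then show ?thesis
      by (simp add: E_def Suc of_rat_divide of_rat_minus del: of_nat_Suc)
  qed
qed

section \<open>The roots of the characteristic polynomial\<close>

definition char_poly_fib :: "nat \<Rightarrow> complex poly" where
  "char_poly_fib l = monom 1 l - (\<Sum>i<l. monom 1 i)"

definition fib_roots :: "nat \<Rightarrow> complex set" where
  "fib_roots l = {z. poly (char_poly_fib l) z = 0}"

lemma poly_char_poly_fib: "poly (char_poly_fib l) z = z ^ l - (\<Sum>i<l. z ^ i)"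
  by (simp add: char_poly_fib_def poly_sum poly_monom)

lemma fib_roots_iff: "z \<in> fib_roots l \<longleftrightarrow> z ^ l = (\<Sum>i<l. z ^ i)"
  by (simp add: fib_roots_def poly_char_poly_fib)

text \<open>The sum telescopes; the resulting trinomial is easier to estimate and to
  differentiate.\<close>

lemma mult_char_fib:
  fixes z :: "'a :: comm_ring_1"
  shows "(z - 1) * (z ^ l - (\<Sum>i<l. z ^ i)) = z ^ Suc l - 2 * z ^ l + 1"
proof -
  have "(z - 1) * (\<Sum>i<l. z ^ i) = z ^ l - 1"
    by (simp add: power_diff_1_eq)
  then show ?thesis by (simp add: algebra_simps)
qed

lemma coeff_char_poly_fib: "coeff (char_poly_fib l) i = (if i = l then 1 else if i < l then -1 else 0)"
  by (auto simp: char_poly_fib_def coeff_sum)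

lemma degree_char_poly_fib: "degree (char_poly_fib l) = l"
proof (rule antisym)
  show "degree (char_poly_fib l) \<le> l" by (rule degree_le) (simp add: coeff_char_poly_fib)
  show "l \<le> degree (char_poly_fib l)" by (rule le_degree) (simp add: coeff_char_poly_fib)
qed

lemma lead_coeff_char_poly_fib: "lead_coeff (char_poly_fib l) = 1"
  by (simp add: degree_char_poly_fib coeff_char_poly_fib)

lemma char_poly_fib_nz [simp]: "char_poly_fib l \<noteq> 0"
  using lead_coeff_char_poly_fib[of l] by auto

lemma finite_fib_roots [simp, intro]: "finite (fib_roots l)"
  unfolding fib_roots_def by (rule poly_roots_finite) simp

lemma fib_root_nz: "l > 0 \<Longrightarrow> z \<in> fib_roots l \<Longrightarrow> z \<noteq> 0"
proof
  assume "l > 0" "z \<in> fib_roots l" "z = 0"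
  then have "(0 :: complex) = (\<Sum>i<l. 0 ^ i)" using fib_roots_iff[of 0 l] by (simp add: zero_power)
  also have "\<dots> = 1" using \<open>l > 0\<close> by (simp add: power_0_left sum.delta)
  finally show False by simp
qed

section \<open>Location and simplicity of the roots\<close>

lemma ex_dominant_root:
  assumes "l \<ge> 2"
  shows "\<exists>a::real. 1 < a \<and> a < 2 \<and> a ^ l = (\<Sum>i<l. a ^ i)"
proof -
  let ?p = "\<lambda>x::real. x ^ l - (\<Sum>i<l. x ^ i)"
  have "?p 1 < 0" using assms by simp
  have "(\<Sum>i<l. (2::real) ^ i) = 2 ^ l - 1" by (induction l) auto
  then have "?p 2 > 0" by simp
  have "\<exists>x\<ge>1. x \<le> 2 \<and> ?p x = 0"
    using \<open>?p 1 < 0\<close> \<open>?p 2 > 0\<close> by (intro IVT') (auto intro!: continuous_intros)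
  then obtain x where x: "x \<ge> 1" "x \<le> 2" "?p x = 0" by blast
  then have "x \<noteq> 1" "x \<noteq> 2" using \<open>?p 1 < 0\<close> \<open>?p 2 > 0\<close> by auto
  with x show ?thesis by (intro exI[of _ x]) auto
qed

definition fib_alpha :: "nat \<Rightarrow> real" where
  "fib_alpha l = (SOME a. 1 < a \<and> a < 2 \<and> a ^ l = (\<Sum>i<l. a ^ i))"

lemma fib_alpha:
  assumes "l \<ge> 2"
  shows "1 < fib_alpha l" "fib_alpha l < 2" "fib_alpha l ^ l = (\<Sum>i<l. fib_alpha l ^ i)"
  using someI_ex[OF ex_dominant_root[OF assms]] unfolding fib_alpha_def by blast+

lemma fib_alpha_root: "l \<ge> 2 \<Longrightarrow> of_real (fib_alpha l) \<in> fib_roots l"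
  using fib_alpha(3)[of l] unfolding fib_roots_iff
  by (metis (no_types, lifting) of_real_power of_real_sum sum.cong)

text \<open>Both inequalities say that the sum of the \<open>r ^ (i - l)\<close> is strictly decreasing in \<open>r\<close>.\<close>

lemma char_fib_neg:
  assumes "l \<ge> 2" "0 < r" "r < fib_alpha l"
  shows "r ^ l < (\<Sum>i<l. r ^ i)"
proof -
  let ?a = "fib_alpha l"
  have a: "?a > 0" using fib_alpha[OF assms(1)] by simp
  have "r ^ l * ?a ^ i < ?a ^ l * r ^ i" if "i < l" for i
  proof -
    have "r ^ (l - i) < ?a ^ (l - i)" using that assms by (intro power_strict_mono) auto
    then have "r ^ (l - i) * (r ^ i * ?a ^ i) < ?a ^ (l - i) * (r ^ i * ?a ^ i)"
      using a assms by (intro mult_strict_right_mono) auto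
    moreover have "r ^ l = r ^ (l - i) * r ^ i" "?a ^ l = ?a ^ (l - i) * ?a ^ i"
      using that by (simp_all flip: power_add)
    ultimately show ?thesis by (simp add: mult_ac)
  qed
  then have "(\<Sum>i<l. r ^ l * ?a ^ i) < (\<Sum>i<l. ?a ^ l * r ^ i)"
    using assms by (intro sum_strict_mono) (auto simp: lessThan_empty_iff)
  then have "r ^ l * ?a ^ l < ?a ^ l * (\<Sum>i<l. r ^ i)"
    by (simp only: sum_distrib_left[symmetric] fib_alpha(3)[OF assms(1), symmetric])
  then show ?thesis using a by simp
qed

lemma char_fib_pos:
  assumes "l \<ge> 2" "r > fib_alpha l"
  shows "r ^ l > (\<Sum>i<l. r ^ i)"
proof -
  let ?a = "fib_alpha l"
  have a: "?a > 0" using fib_alpha[OF assms(1)] by simp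
  have "r ^ l * ?a ^ i > ?a ^ l * r ^ i" if "i < l" for i
  proof -
    have "r ^ (l - i) > ?a ^ (l - i)" using that assms a by (intro power_strict_mono) auto
    then have "r ^ (l - i) * (r ^ i * ?a ^ i) > ?a ^ (l - i) * (r ^ i * ?a ^ i)"
      using a assms by (intro mult_strict_right_mono) auto
    moreover have "r ^ l = r ^ (l - i) * r ^ i" "?a ^ l = ?a ^ (l - i) * ?a ^ i"
      using that by (simp_all flip: power_add)
    ultimately show ?thesis by (simp add: mult_ac)
  qed
  then have "(\<Sum>i<l. r ^ l * ?a ^ i) > (\<Sum>i<l. ?a ^ l * r ^ i)"
    using assms by (intro sum_strict_mono) (auto simp: lessThan_empty_iff)
  then have "r ^ l * ?a ^ l > ?a ^ l * (\<Sum>i<l. r ^ i)"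
    by (simp only: sum_distrib_left[symmetric] fib_alpha(3)[OF assms(1), symmetric])
  then show ?thesis using a by simp
qed

text \<open>If \<open>r = norm z\<close> were at least \<open>1\<close>, the triangle inequality
  would give \<open>r \<le> fib_alpha l\<close>, and the trinomial
  \<open>r ^ l * (2 - r) \<le> 1\<close>. Together they leave only \<open>r = 1\<close> or
  \<open>r = fib_alpha l\<close>, and equality in the second estimate.\<close>

lemma norm_fib_root_less_1:
  assumes l: "l \<ge> 2" and z: "z \<in> fib_roots l" "z \<noteq> of_real (fib_alpha l)"
  shows "norm z < 1"
proof (rule ccontr)
  assume "\<not> norm z < 1"
  define r where "r = norm z"
  have r1: "r \<ge> 1" using \<open>\<not> norm z < 1\<close> by (simp add: r_def)
  have "r ^ l = norm (\<Sum>i<l. z ^ i)"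
    using z(1) by (simp add: r_def fib_roots_iff flip: norm_power)
  also have "\<dots> \<le> (\<Sum>i<l. r ^ i)"
    unfolding r_def by (rule order.trans[OF norm_sum]) (simp add: norm_power)
  finally have "r \<le> fib_alpha l" using char_fib_pos[OF l, of r] by fastforce
  have "z ^ Suc l - 2 * z ^ l + 1 = 0"
    using mult_char_fib[of z l] z(1) by (simp add: fib_roots_iff)
  then have "z ^ l * (2 - z) = 1" by (simp add: algebra_simps)
  then have eq: "r ^ l * norm (2 - z) = 1"
    by (metis norm_mult norm_one norm_power r_def)
  have re: "2 - r \<le> Re (2 - z)" "Re (2 - z) \<le> norm (2 - z)"
    using complex_Re_le_cmod[of z] complex_Re_le_cmod[of "2 - z"] by (auto simp: r_def)
  have "r ^ l * (2 - r) \<le> r ^ l * norm (2 - z)" 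
    using re r1 by (intro mult_left_mono) auto
  then have le: "r ^ l * (2 - r) \<le> 1" using eq by simp
  have "r ^ l * (2 - r) = 1"
  proof (cases "r = 1")
    case False
    have "(r - 1) * (r ^ l - (\<Sum>i<l. r ^ i)) \<ge> 0"
      unfolding mult_char_fib using le by (simp add: algebra_simps)
    then have "r ^ l \<ge> (\<Sum>i<l. r ^ i)" using r1 False by (simp add: zero_le_mult_iff)
    then have "r = fib_alpha l" using char_fib_neg[OF l, of r] r1 \<open>r \<le> fib_alpha l\<close> by force
    then have "(r - 1) * (r ^ l - (\<Sum>i<l. r ^ i)) = 0" using fib_alpha(3)[OF l] by simp
    then show ?thesis unfolding mult_char_fib by (simp add: algebra_simps)
  qed auto
  \<comment> \<open>Equality in the triangle inequality forces \<open>z\<close> to be the real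
    number \<open>r\<close>.\<close>
  then have "norm (2 - z) = 2 - r" using eq r1
    by (metis mult_cancel_left mult_zero_left zero_neq_one)
  then have "Re z = norm z" using re by (simp add: r_def)
  then have "Im z = 0" using cmod_power2[of z] by simp
  with \<open>Re z = norm z\<close> have zr: "z = of_real r"
    by (simp add: complex_eq_iff r_def)
  have "of_real (r ^ l) = (of_real (\<Sum>i<l. r ^ i) :: complex)"
    using z(1) zr by (simp add: fib_roots_iff)
  then have "r ^ l = (\<Sum>i<l. r ^ i)" using of_real_eq_iff by blast
  moreover have "r \<noteq> fib_alpha l" using z zr by auto
  ultimately show False using \<open>r \<le> fib_alpha l\<close> char_fib_neg[OF l, of r] r1 by force
qed

lemma pderiv_sum: "pderiv (\<Sum>i\<in>A. p i) = (\<Sum>i\<in>A. pderiv (p i))"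
  by (induction A rule: infinite_finite_induct) (simp_all add: pderiv_add)

text \<open>A multiple root would also be one of the trinomial, whose derivative has
  \<open>2 * l / (l + 1)\<close> as its only nonzero root. This exceeds \<open>1\<close>, so only
  the dominant root remains, where the derivative is seen to be nonzero.\<close>

lemma fib_root_simple:
  assumes l: "l \<ge> 2" and z: "z \<in> fib_roots l"
  shows "poly (pderiv (char_poly_fib l)) z \<noteq> 0"
proof
  assume d: "poly (pderiv (char_poly_fib l)) z = 0"
  have z0: "z \<noteq> 0" using fib_root_nz[of l z] z l by simp
  have "[:-1, 1:] * char_poly_fib l = monom 1 (Suc l) - 2 * monom 1 l + 1"
  proof (rule poly_eq_poly_eq_iff[THEN iffD1], rule ext)
    show "poly ([:-1, 1:] * char_poly_fib l) x = poly (monom 1 (Suc l) - 2 * monom 1 l + 1) x" for x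
      using mult_char_fib[of x l] by (simp add: poly_char_poly_fib poly_monom algebra_simps)
  qed
  then have "poly (pderiv ([:-1, 1:] * char_poly_fib l)) z =
    poly (pderiv (monom 1 (Suc l) - 2 * monom 1 l + 1)) z" by simp
  then have "of_nat (Suc l) * z ^ l = 2 * of_nat l * z ^ (l - 1)"
    using d z by (simp add: pderiv_mult pderiv_add pderiv_diff pderiv_monom poly_monom
        fib_roots_def pderiv_1 pderiv_pCons pderiv_numeral)
  also have "z ^ l = z * z ^ (l - 1)" using l by (cases l) auto
  finally have "z ^ (l - 1) * (of_nat (Suc l) * z) = z ^ (l - 1) * (2 * of_nat l)" 
    by (simp only: mult_ac)
  then have "of_nat (Suc l) * z = 2 * of_nat l" using z0 by simp
  then have "norm (of_nat (Suc l) * z) = norm (2 * of_nat l :: complex)" by simp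
  then have "real (Suc l) * norm z = 2 * real l"
    by (simp only: norm_mult norm_of_nat norm_numeral)
  moreover have "real (Suc l) * norm z < real (Suc l) * 1" if "norm z < 1"
    using that by (intro mult_strict_left_mono) auto
  ultimately have "norm z \<ge> 1" using l by fastforce
  then have za: "z = of_real (fib_alpha l)" using norm_fib_root_less_1[OF l z] by force
  let ?a = "fib_alpha l"
  have "z * poly (pderiv (char_poly_fib l)) z = of_nat l * z ^ l - (\<Sum>i<l. of_nat i * z ^ i)"
  proof -
    have *: "z * (of_nat i * z ^ (i - Suc 0)) = of_nat i * z ^ i" for i by (cases i) auto
    show ?thesis
      by (simp add: * char_poly_fib_def pderiv_diff pderiv_sum pderiv_monom poly_sum poly_monom
        right_diff_distrib sum_distrib_left)
  qed
  \<comment> \<open>The root equation replaces \<open>z ^ l\<close> by the lower powers, which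
    leaves only positive weights.\<close>
  also have "\<dots> = of_real (\<Sum>i<l. (real l - real i) * ?a ^ i)"
    using fib_alpha(3)[OF l] z
    by (simp add: za fib_roots_iff sum_distrib_left sum_subtractf left_diff_distrib flip: of_real_power)
  finally have "(\<Sum>i<l. (real l - real i) * ?a ^ i) = 0" using d
    by (metis mult_zero_right of_real_eq_0_iff)
  moreover have "(\<Sum>i<l. (real l - real i) * ?a ^ i) > 0"
    using l fib_alpha[OF l] by (intro sum_pos mult_pos_pos) auto
  ultimately show False by simp
qed

lemma char_poly_fib_eq_prod:
  assumes "l \<ge> 2"
  shows "char_poly_fib l = (\<Prod>z\<in>fib_roots l. [:- z, 1:])"
proof -
  have "rsquarefree (char_poly_fib l)"
    using fib_root_simple[OF assms] by (auto simp: rsquarefree_roots fib_roots_def)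
  then show ?thesis
    using complex_poly_decompose_rsquarefree[of "char_poly_fib l"] lead_coeff_char_poly_fib[of l]
    by (simp add: fib_roots_def)
qed

lemma card_fib_roots:
  assumes "l \<ge> 2" shows "card (fib_roots l) = l"
proof -
  have "l = degree (\<Prod>z\<in>fib_roots l. [:- z, 1:])"
    by (simp add: char_poly_fib_eq_prod[OF assms, symmetric] degree_char_poly_fib)
  also have "\<dots> = card (fib_roots l)" by (subst degree_prod_sum_eq) auto
  finally show ?thesis by simp
qed

text \<open>By Vieta the product is \<open>1\<close> or \<open>-1\<close> depending on the parity of
  \<open>l\<close>; the square avoids the distinction.\<close>

lemma prod_fib_roots:
  assumes "l \<ge> 2" shows "(\<Prod>z\<in>fib_roots l. z) ^ 2 = 1"
proof -
  have "poly (char_poly_fib l) 0 = (\<Prod>z\<in>fib_roots l. - z)"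
    by (simp add: char_poly_fib_eq_prod[OF assms] poly_prod)
  also have "\<dots> = (-1) ^ l * (\<Prod>z\<in>fib_roots l. z)"
    by (subst prod_uminus) (simp add: card_fib_roots[OF assms])
  also have "poly (char_poly_fib l) 0 = -1"
    using assms by (simp add: poly_0_coeff_0 coeff_char_poly_fib)
  finally have "(-1) ^ 2 = ((-1) ^ l * (\<Prod>z\<in>fib_roots l. z)) ^ 2" by metis
  then show ?thesis by (simp add: power_mult_distrib flip: power_mult)
qed

text \<open>The reflected characteristic polynomial has integer coefficients and is the product of
  the factors \<open>[:1, - z:]\<close> in Newton's identities.\<close>

lemma fib_power_sum_Ints:
  assumes "l \<ge> 2" shows "(\<Sum>z\<in>fib_roots l. z ^ n) \<in> \<int>"
proof (rule power_sum_Ints)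
  have "reflect_poly [:- z, 1:] = [:1, - z:]" if "z \<in> fib_roots l" for z
    using fib_root_nz[of l z] that assms by (simp add: reflect_poly_def)
  then have "reflect_poly (char_poly_fib l) = (\<Prod>z\<in>fib_roots l. [:1, - z:])"
    by (simp add: char_poly_fib_eq_prod[OF assms] reflect_poly_prod)
  then show "coeff (\<Prod>z\<in>fib_roots l. [:1, - z:]) k \<in> \<int>" for k
    by (simp add: coeff_reflect_poly coeff_char_poly_fib flip: \<open>reflect_poly _ = _\<close>)
qed simp

section \<open>Binet's formula\<close>

text \<open>Lagrange interpolation of \<open>X ^ k\<close> at the \<open>d + 1\<close> points of
  \<open>A\<close>; the claim compares the coefficients of \<open>X ^ d\<close>.\<close>

lemma sum_power_over_differences:
  fixes A :: "'a::field set"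
  assumes "finite A" "card A = Suc d" "k \<le> d"
  shows "(\<Sum>a\<in>A. a ^ k / (\<Prod>b\<in>A - {a}. a - b)) = (if k = d then 1 else 0)"
proof -
  define w where "w a = (\<Prod>b\<in>A - {a}. a - b)" for a
  define L where "L a = (\<Prod>b\<in>A - {a}. [:- b, 1:])" for a
  have w: "w a \<noteq> 0" for a using assms(1) by (auto simp: w_def)
  have pL: "poly (L a) b = (if b = a then w a else 0)" if "a \<in> A" "b \<in> A" for a b
    using that assms(1) by (auto simp: L_def w_def poly_prod)
  have dL: "degree (L a) = d" "coeff (L a) d = 1" if "a \<in> A" for a
  proof -
    show "degree (L a) = d" unfolding L_def using that assms by (subst degree_prod_sum_eq) auto
    then show "coeff (L a) d = 1"
      using lead_coeff_prod[of "\<lambda>b. [:- b, 1:]" "A - {a}"] by (simp add: L_def)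
  qed
  define p where "p = (\<Sum>a\<in>A. smult (a ^ k / w a) (L a))"
  have "monom 1 k = p"
  proof (rule poly_eqI_degree)
    show "poly (monom 1 k) x = poly p x" if "x \<in> A" for x
    proof -
      have "poly p x = (\<Sum>a\<in>A. if a = x then a ^ k else 0)"
        unfolding p_def poly_sum using that w by (intro sum.cong) (auto simp: pL)
      then show ?thesis using that assms(1) by (simp add: poly_monom)
    qed
    show "card A > degree (monom (1::'a) k)" using assms by (simp add: degree_monom_eq)
    have "degree p \<le> d" unfolding p_def
      by (intro degree_sum_le assms) (auto intro: order.trans[OF degree_smult_le] simp: dL)
    then show "card A > degree p" using assms by simp
  qed
  then have "coeff (monom 1 k) d = coeff p d" by simp
  then show ?thesis by (simp add: p_def coeff_sum dL w_def eq_commute)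
qed

text \<open>The interpolation sums with exponents \<open>0\<close> to \<open>l - 1\<close> are the
  initial values at the indices \<open>2 - l\<close> to \<open>1\<close>; the power
  \<open>l - 2\<close> undoes this shift.\<close>

definition binet_coeff :: "nat \<Rightarrow> complex \<Rightarrow> complex" where
  "binet_coeff l r = r ^ (l - 2) / (\<Prod>q\<in>fib_roots l - {r}. r - q)"

lemma binet_coeff_nz: "l \<ge> 2 \<Longrightarrow> r \<in> fib_roots l \<Longrightarrow> binet_coeff l r \<noteq> 0"
  using fib_root_nz[of l r] by (auto simp: binet_coeff_def)

text \<open>The interpolation sums supply the initial values \<open>0, ..., 0, 1\<close>, and each
  \<open>r ^ k\<close> satisfies the recurrence.\<close>

lemma binet:
  assumes l: "l \<ge> 2"
  shows "of_nat (gen_fib l (int n)) = (\<Sum>r\<in>fib_roots l. binet_coeff l r * r ^ n)"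
proof -
  define L where "L k = (\<Sum>r\<in>fib_roots l. r ^ k / (\<Prod>q\<in>fib_roots l - {r}. r - q))" for k
  have *: "of_nat (gen_fib l (int k + 2 - int l)) = L k" for k
  proof (induction k rule: less_induct)
    case (less k)
    show ?case
    proof (cases "k < l")
      case True
      have "L k = (if k = l - 1 then 1 else 0)"
        unfolding L_def using True l by (intro sum_power_over_differences) (auto simp: card_fib_roots)
      moreover have "gen_fib l (int k + 2 - int l) = (if k = l - 1 then 1 else 0)"
        using True l by (subst gen_fib.simps) (auto simp: of_nat_diff)
      ultimately show ?thesis by simp
    next
      case False
      have "gen_fib l (int k + 2 - int l) = (\<Sum>i=1..l. gen_fib l (int k + 2 - int l - int i))"
        using False by (subst gen_fib.simps) auto
      also have "of_nat \<dots> = (\<Sum>i=1..l. L (k - i))"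
        unfolding of_nat_sum
      proof (intro sum.cong refl)
        fix i assume "i \<in> {1..l}"
        then show "complex_of_nat (gen_fib l (int k + 2 - int l - int i)) = L (k - i)"
          using less[of "k - i"] False by (simp add: of_nat_diff algebra_simps)
      qed
      also have "\<dots> = (\<Sum>r\<in>fib_roots l. (\<Sum>i=1..l. r ^ (k - i)) / (\<Prod>q\<in>fib_roots l - {r}. r - q))"
        unfolding L_def by (subst sum.swap) (simp add: sum_divide_distrib)
      also have "\<dots> = L k"
        unfolding L_def
      proof (intro sum.cong refl)
        fix r assume "r \<in> fib_roots l"
        then have "r ^ k = r ^ (k - l) * (\<Sum>i<l. r ^ i)"
          using False by (simp add: fib_roots_iff[THEN iffD1, symmetric] flip: power_add)
        also have "\<dots> = (\<Sum>i<l. r ^ (k - l + i))" by (simp add: sum_distrib_left power_add)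
        also have "\<dots> = (\<Sum>i=1..l. r ^ (k - i))"
          using False by (intro sum.reindex_bij_witness[of _ "\<lambda>i. l - i" "\<lambda>i. l - i"]) auto
        finally show "(\<Sum>i=1..l. r ^ (k - i)) / (\<Prod>q\<in>fib_roots l - {r}. r - q) =
           r ^ k / (\<Prod>q\<in>fib_roots l - {r}. r - q)" by simp
      qed
      finally show ?thesis .
    qed
  qed
  have "of_nat (gen_fib l (int n)) = L (n + l - 2)"
    using *[of "n + l - 2"] l by (simp add: of_nat_diff)
  also have "\<dots> = (\<Sum>r\<in>fib_roots l. binet_coeff l r * r ^ n)"
    unfolding L_def binet_coeff_def
    by (intro sum.cong refl) (use l in \<open>simp flip: power_add add: add.commute\<close>)
  finally show ?thesis .
qed

lemma gen_fib_pos: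
  assumes "l \<ge> 2" "n > 0" shows "gen_fib l (int n) > 0"
  using assms(2)
proof (induction n rule: less_induct)
  case (less n)
  show ?case
  proof (cases "n = 1")
    case False
    have "0 < gen_fib l (int (n - 1))" using less.IH[of "n - 1"] less.prems False by simp
    also have "\<dots> = gen_fib l (int n - int 1)" using less.prems by (simp add: of_nat_diff)
    also have "\<dots> \<le> (\<Sum>i=1..l. gen_fib l (int n - int i))"
      using assms(1) by (intro member_le_sum) auto
    also have "\<dots> = gen_fib l (int n)"
      using less.prems False by (subst (2) gen_fib.simps) auto
    finally show ?thesis .
  qed (simp add: gen_fib.simps)
qed

section \<open>Multiplicative relations between the roots\<close>

definition rat_char_poly_fib :: "nat \<Rightarrow> rat poly" where
  "rat_char_poly_fib l = monom 1 l - (\<Sum>i<l. monom 1 i)"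

lemma rpoly_char_poly_fib: "rpoly (rat_char_poly_fib l) z = poly (char_poly_fib l) z"
  by (simp add: rat_char_poly_fib_def poly_char_poly_fib)

text \<open>The power sums of the roots are integers, so a common denominator of the coefficients of
  \<open>h\<close> works for every \<open>N\<close>.\<close>

lemma fib_trace_bounded_denominator:
  assumes l: "l \<ge> 2"
  shows "\<exists>M::int. M \<noteq> 0 \<and> (\<forall>N. of_int M * (\<Sum>z\<in>fib_roots l. rpoly h z * z ^ N) \<in> \<int>)"
proof (induction h)
  case 0
  show ?case by (intro exI[of _ 1]) simp
next
  case (pCons a h)
  obtain M where M: "M \<noteq> 0" "\<And>N. of_int M * (\<Sum>z\<in>fib_roots l. rpoly h z * z ^ N) \<in> \<int>"
    using pCons.IH by blast
  obtain n d where nd: "quotient_of a = (n, d)" by (cases "quotient_of a")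
  have d: "d > 0" "a = of_int n / of_int d"
    using quotient_of_denom_pos[OF nd] quotient_of_div[OF nd] by auto
  show ?case
  proof (intro exI[of _ "d * M"] conjI allI)
    fix N
    have "of_int (d * M) * (\<Sum>z\<in>fib_roots l. rpoly (pCons a h) z * z ^ N) =
      of_int (M * n) * (\<Sum>z\<in>fib_roots l. z ^ N) +
      of_int d * (of_int M * (\<Sum>z\<in>fib_roots l. rpoly h z * z ^ Suc N))"
      using d by (simp add: of_rat_divide algebra_simps sum.distrib sum_distrib_left)
    also have "\<dots> \<in> \<int>"
      by (intro Ints_add Ints_mult[OF Ints_of_int M(2)] Ints_mult[OF Ints_of_int fib_power_sum_Ints[OF l]])
    finally show "of_int (d * M) * (\<Sum>z\<in>fib_roots l. rpoly (pCons a h) z * z ^ N) \<in> \<int>" .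
  qed (use d M in auto)
qed

text \<open>The combination of shifted sums with the coefficients of a polynomial vanishing on
  \<open>A - {a}\<close> isolates the term of \<open>a\<close>.\<close>

lemma exponential_sum_eventually_0:
  fixes w :: "'a :: field \<Rightarrow> 'a"
  assumes "finite A" "0 \<notin> A" "\<And>N. N \<ge> N0 \<Longrightarrow> (\<Sum>a\<in>A. w a * a ^ N) = 0" "a \<in> A"
  shows "w a = 0"
proof -
  define q where "q = (\<Prod>b\<in>A - {a}. [:- b, 1:])"
  have "(\<Sum>b\<in>A. w b * b ^ N0 * poly q b) = (\<Sum>i\<le>degree q. coeff q i * (\<Sum>b\<in>A. w b * b ^ (N0 + i)))"
    unfolding poly_altdef sum_distrib_left
    by (subst sum.swap) (simp add: power_add mult_ac)
  also have "\<dots> = 0" using assms(3) by simp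
  also have "(\<Sum>b\<in>A. w b * b ^ N0 * poly q b) = (\<Sum>b\<in>A. if b = a then w b * b ^ N0 * poly q b else 0)"
    using assms(1) by (intro sum.cong) (auto simp: q_def poly_prod)
  also have "\<dots> = w a * a ^ N0 * poly q a" using assms by simp
  finally have "w a * a ^ N0 * poly q a = 0" .
  moreover have "poly q a \<noteq> 0" using assms(1) by (simp add: q_def poly_prod)
  moreover have "a \<noteq> 0" using assms by auto
  ultimately show ?thesis by simp
qed

text \<open>
  This is the irreducibility of the characteristic polynomial over the rationals. If a factor \<open>h\<close>
  vanishes at the dominant root, then the traces of \<open>h(z) z ^ N\<close> are rational with bounded
  denominators and tend to \<open>0\<close>, so they are eventually \<open>0\<close>, and \<open>h\<close> vanishes at every root.
\<close>

lemma rpoly_vanishes_at_dominant_root: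
  assumes l: "l \<ge> 2" and j: "j \<in> fib_roots l" "rpoly D j = 0"
  shows "rpoly D (of_real (fib_alpha l)) = 0"
proof (rule ccontr)
  assume D: "rpoly D (of_real (fib_alpha l)) \<noteq> 0"
  define q where "q = rat_char_poly_fib l"
  have q0: "q \<noteq> 0" using rpoly_char_poly_fib[of l "0"] l
    by (auto simp: q_def[symmetric] poly_0_coeff_0 coeff_char_poly_fib)
  have qr: "rpoly q z = 0 \<longleftrightarrow> z \<in> fib_roots l" for z
    by (simp add: q_def rpoly_char_poly_fib fib_roots_def)
  \<comment> \<open>\<open>g\<close> is a minimal polynomial of \<open>j\<close>, so it divides
    every rational polynomial that vanishes at \<open>j\<close>.\<close>
  obtain g where g: "g \<noteq> 0" "rpoly g j = 0"
    "\<And>p. p \<noteq> 0 \<Longrightarrow> rpoly p j = 0 \<Longrightarrow> degree g \<le> degree p"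
    using ex_has_least_nat[of "\<lambda>p. p \<noteq> 0 \<and> rpoly p j = 0" q degree] q0 j qr by blast
  have dvd: "g dvd p" if "rpoly p j = 0" for p
  proof (rule ccontr)
    assume "\<not> g dvd p"
    then have "p mod g \<noteq> 0" by (simp add: dvd_eq_mod_eq_0)
    moreover have "rpoly (p mod g) j = 0"
      using that g(2) by (simp add: minus_div_mult_eq_mod[symmetric])
    ultimately have "degree g \<le> degree (p mod g)" using g(3) by blast
    moreover have "degree (p mod g) < degree g" using degree_mod_less[OF g(1), of p] \<open>p mod g \<noteq> 0\<close> by simp
    ultimately show False by simp
  qed
  \<comment> \<open>\<open>D\<close> is a multiple of \<open>g\<close> that does not vanish at the
    dominant root, so \<open>g\<close> does not vanish there and the cofactor \<open>h\<close>
    must.\<close>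
  obtain h where h: "q = g * h" using dvd[of q] qr j by (auto elim: dvdE)
  obtain k where "D = g * k" using dvd[of D] j by (auto elim: dvdE)
  then have "rpoly g (of_real (fib_alpha l)) \<noteq> 0" using D by auto
  moreover have "rpoly q (of_real (fib_alpha l)) = 0" using qr fib_alpha_root[OF l] by blast
  ultimately have ha: "rpoly h (of_real (fib_alpha l)) = 0" using h by simp
  \<comment> \<open>Otherwise \<open>g\<close> would divide \<open>q\<close> twice, and
    \<open>j\<close> would be a multiple root.\<close>
  have hj: "rpoly h j \<noteq> 0"
  proof
    assume "rpoly h j = 0"
    then obtain k where "h = g * k" using dvd[of h] by (auto elim: dvdE)
    then have qgk: "q = g * g * k" using h by (simp add: mult.assoc)
    define c where "c p = (map_poly of_rat p :: complex poly)" for p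
    have "char_poly_fib l = c g * c g * c k"
    proof (rule poly_eq_poly_eq_iff[THEN iffD1], rule ext)
      fix z
      have "poly (char_poly_fib l) z = rpoly q z" by (simp add: q_def rpoly_char_poly_fib)
      also have "\<dots> = poly (c g * c g * c k) z"
        unfolding qgk rpoly_mult by (simp add: c_def rpoly_def)
      finally show "poly (char_poly_fib l) z = poly (c g * c g * c k) z" .
    qed
    moreover have "poly (c g) j = 0" using g(2) by (simp add: c_def rpoly_def)
    ultimately have "poly (pderiv (char_poly_fib l)) j = 0" by (simp add: pderiv_mult)
    then show False using fib_root_simple[OF l j(1)] by simp
  qed
  obtain M where M: "M \<noteq> 0" "\<And>N. of_int M * (\<Sum>z\<in>fib_roots l. rpoly h z * z ^ N) \<in> \<int>"
    using fib_trace_bounded_denominator[OF l, of h] by blast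
  have "(\<lambda>N. rpoly h z * z ^ N) \<longlonglongrightarrow> 0" if "z \<in> fib_roots l" for z
  proof (cases "z = of_real (fib_alpha l)")
    case False
    then show ?thesis
      using norm_fib_root_less_1[OF l that] by (intro tendsto_mult_right_zero LIMSEQ_power_zero)
  qed (simp add: ha)
  then have "(\<lambda>N. of_int M * (\<Sum>z\<in>fib_roots l. rpoly h z * z ^ N)) \<longlonglongrightarrow> of_int M * (\<Sum>z\<in>fib_roots l. 0)"
    by (intro tendsto_intros)
  then have "\<forall>\<^sub>F N in sequentially. dist (of_int M * (\<Sum>z\<in>fib_roots l. rpoly h z * z ^ N)) 0 < 1"
    by (intro tendstoD) auto
  then obtain N0 where N0: "\<And>N. N \<ge> N0 \<Longrightarrow> norm (of_int M * (\<Sum>z\<in>fib_roots l. rpoly h z * z ^ N)) < 1"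
    by (auto simp: eventually_sequentially)
  have trace_0: "(\<Sum>z\<in>fib_roots l. rpoly h z * z ^ N) = 0" if "N \<ge> N0" for N
  proof -
    obtain i where i: "of_int M * (\<Sum>z\<in>fib_roots l. rpoly h z * z ^ N) = of_int i"
      using M(2)[of N] by (auto elim: Ints_cases)
    then have "norm (of_int i :: complex) < 1" using N0[OF that] by simp
    then have "i = 0" by simp
    then show ?thesis using i M(1) by simp
  qed
  have "0 \<notin> fib_roots l" using fib_root_nz[of l 0] l by auto
  then have "rpoly h j = 0"
    using exponential_sum_eventually_0[where w = "rpoly h", OF finite_fib_roots _ trace_0 j(1)] by blast
  then show False using hj by simp
qed

text \<open>
  The product over all maps \<open>\<tau>\<close> from the roots other than \<open>j\<close> to the roots other than \<open>t\<close> of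
  \<open>1 - (\<Prod>r. \<tau> r ^ e r)\<close> is a rational polynomial in \<open>t\<close>. It vanishes at \<open>t = j\<close>, hence at
  the dominant root; but all the other roots lie in the open unit disc.
\<close>

lemma fib_roots_mult_independent:
  assumes l: "l \<ge> 2" and j: "j \<in> fib_roots l"
    and e: "(\<Prod>r\<in>fib_roots l - {j}. r ^ e r) = 1" and r0: "r0 \<in> fib_roots l - {j}"
  shows "e r0 = (0::nat)"
proof (rule ccontr)
  assume er0: "e r0 \<noteq> 0"
  let ?R = "fib_roots l" let ?a = "complex_of_real (fib_alpha l)"
  define T where "T t = (?R - {j}) \<rightarrow>\<^sub>E (?R - {t})" for t
  define f where "f \<tau> = (\<Prod>r\<in>?R - {j}. \<tau> r ^ e r)" for \<tau> :: "complex \<Rightarrow> complex"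
  have finT: "finite (T t)" for t by (auto simp: T_def intro: finite_PiE)
  have "\<exists>q. (\<Sum>z\<in>?R. z ^ n) = of_rat q" for n
    using fib_power_sum_Ints[OF l, of n] by (metis Ints_cases of_rat_of_int_eq)
  then obtain p where p: "\<And>n. (\<Sum>z\<in>?R. z ^ n) = of_rat (p n)" by metis
  \<comment> \<open>The sum over all maps factorizes; each argument contributes the power sum over
    the roots other than \<open>t\<close>, which is the full power sum minus a power of
    \<open>t\<close>.\<close>
  define S where "S n = (\<Prod>r\<in>?R - {j}. [:p (e r * n):] - monom 1 (e r * n))" for n
  have S: "(\<Sum>\<tau>\<in>T t. f \<tau> ^ n) = rpoly (S n) t" if "t \<in> ?R" for t n
  proof -
    have "(\<Sum>\<tau>\<in>T t. f \<tau> ^ n) = (\<Sum>\<tau>\<in>T t. \<Prod>r\<in>?R - {j}. \<tau> r ^ (e r * n))"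
      by (simp add: f_def prod_power_distrib power_mult)
    also have "\<dots> = (\<Prod>r\<in>?R - {j}. \<Sum>q\<in>?R - {t}. q ^ (e r * n))"
      unfolding T_def by (subst prod_sum_PiE) auto
    also have "\<dots> = (\<Prod>r\<in>?R - {j}. of_rat (p (e r * n)) - t ^ (e r * n))"
      using that by (simp add: sum_diff1 p)
    also have "\<dots> = rpoly (S n) t" by (simp add: S_def)
    finally show ?thesis .
  qed
  \<comment> \<open>The number of maps in \<open>T t\<close> is the same for all roots
    \<open>t\<close>, so adding the coefficients up to \<open>d\<close>, that is, evaluating at
    \<open>1\<close>, gives a single polynomial \<open>D\<close>.\<close>
  define d where "d = (l - 1) ^ (l - 1)"
  define D where "D = (\<Sum>n\<le>d. newton_coeff S n)"
  have D: "rpoly D t = (\<Prod>\<tau>\<in>T t. 1 - f \<tau>)" if t: "t \<in> ?R" for t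
  proof -
    define E where "E = (\<Prod>\<tau>\<in>T t. [:1, - f \<tau>:])"
    have "card (T t) = d"
      using t j by (simp add: T_def card_PiE card_Diff_singleton card_fib_roots[OF l] d_def)
    have "degree E \<le> (\<Sum>\<tau>\<in>T t. degree [:1, - f \<tau>:])"
      unfolding E_def using degree_prod_sum_le[OF finT, of "\<lambda>\<tau>. [:1, - f \<tau>:]" t] by (simp add: o_def)
    also have "\<dots> \<le> (\<Sum>\<tau>\<in>T t. 1)" by (intro sum_mono) auto
    finally have "degree E \<le> d" using \<open>card (T t) = d\<close> by simp
    have "rpoly D t = (\<Sum>n\<le>d. coeff E n)"
      unfolding D_def rpoly_sum E_def
      by (intro sum.cong coeff_prod_linear_eq_newton_coeff[symmetric] refl finT S t)
    also have "\<dots> = poly E 1"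
      unfolding poly_altdef using \<open>degree E \<le> d\<close>
      by (simp, intro sum.mono_neutral_right) (auto simp: coeff_eq_0)
    also have "\<dots> = (\<Prod>\<tau>\<in>T t. 1 - f \<tau>)" by (simp add: E_def poly_prod)
    finally show ?thesis .
  qed
  \<comment> \<open>The identity map is admissible for \<open>t = j\<close>, and the assumed
    relation makes its factor vanish.\<close>
  have "restrict (\<lambda>r. r) (?R - {j}) \<in> T j" "f (restrict (\<lambda>r. r) (?R - {j})) = 1"
    using e by (auto simp: T_def f_def)
  then have "rpoly D j = 0" unfolding D[OF j] using finT by force
  then have "rpoly D ?a = 0" by (rule rpoly_vanishes_at_dominant_root[OF l j])
  then obtain \<tau> where \<tau>: "\<tau> \<in> T ?a" "f \<tau> = 1"
    unfolding D[OF fib_alpha_root[OF l]] using finT[of ?a] by auto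
  have lt: "norm (\<tau> r) < 1" if "r \<in> ?R - {j}" for r
    using norm_fib_root_less_1[OF l, of "\<tau> r"] \<tau>(1) that by (auto simp: T_def)
  have "norm (f \<tau>) = norm (\<tau> r0) ^ e r0 * (\<Prod>r\<in>?R - {j} - {r0}. norm (\<tau> r) ^ e r)"
    unfolding f_def prod_norm[symmetric] norm_power using r0 by (subst prod.remove[of _ r0]) auto
  also have "\<dots> \<le> norm (\<tau> r0) ^ e r0 * 1"
    using lt by (intro mult_left_mono prod_le_1 conjI power_le_one less_imp_le[OF lt]) auto
  also have "\<dots> < 1" using power_strict_mono[OF lt[OF r0], of "e r0"] er0 by simp
  finally show False using \<tau>(2) by simp
qed

text \<open>With \<open>j\<close> a root of maximal exponent \<open>M\<close>, the relation is
  compared with the \<open>M\<close>-th power of the product of all roots. The quotient has natural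
  exponents and omits \<open>j\<close>, so independence applies; the exponents are doubled because
  that product may be \<open>-1\<close>.\<close>

lemma fib_roots_relation_constant:
  assumes l: "l \<ge> 2" and n: "(\<Prod>r\<in>fib_roots l. r ^ n r) = 1"
  shows "\<exists>k::nat. \<forall>r\<in>fib_roots l. n r = k"
proof -
  let ?R = "fib_roots l"
  define M where "M = Max (n ` ?R)"
  have ne: "?R \<noteq> {}" using fib_alpha_root[OF l] by auto
  have le: "n r \<le> M" if "r \<in> ?R" for r using that by (simp add: M_def)
  have "M \<in> n ` ?R" unfolding M_def using ne by (intro Max_in) auto
  then obtain j where j: "j \<in> ?R" "n j = M" by auto
  have "(\<Prod>r\<in>?R. r ^ (2 * (M - n r))) * (\<Prod>r\<in>?R. r ^ n r) ^ 2 = (\<Prod>r\<in>?R. r ^ (2 * M))"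
    unfolding prod_power_distrib prod.distrib[symmetric]
  proof (intro prod.cong refl)
    fix r assume "r \<in> ?R"
    then have "2 * (M - n r) + n r * 2 = 2 * M" using le[of r] by simp
    then show "r ^ (2 * (M - n r)) * (r ^ n r) ^ 2 = r ^ (2 * M)" by (simp flip: power_add power_mult)
  qed
  also have "\<dots> = ((\<Prod>r\<in>?R. r) ^ 2) ^ M" by (simp add: prod_power_distrib power_mult)
  finally have "(\<Prod>r\<in>?R. r ^ (2 * (M - n r))) = 1" by (simp add: n prod_fib_roots[OF l])
  also have "(\<Prod>r\<in>?R. r ^ (2 * (M - n r))) = (\<Prod>r\<in>?R - {j}. r ^ (2 * (M - n r)))"
    using j by (subst prod.remove[of _ j]) auto
  finally have rel: "(\<Prod>r\<in>?R - {j}. r ^ (2 * (M - n r))) = 1" .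
  have "n r = M" if "r \<in> ?R" for r
  proof (cases "r = j")
    case False
    then have "2 * (M - n r) = 0"
      using fib_roots_mult_independent[OF l j(1) rel, of r] that by simp
    then show ?thesis using le[OF that] by simp
  qed (simp add: j)
  then show ?thesis by blast
qed

text \<open>Grouping equal entries turns the product into a relation whose exponents are the
  multiplicities.\<close>

lemma fib_roots_tuple_relation:
  fixes m :: nat
  assumes l: "l \<ge> 2" and v: "v \<in> {..<m} \<rightarrow> fib_roots l" "(\<Prod>i<m. v i) = 1"
  shows "\<exists>k. \<forall>r\<in>fib_roots l. card {i\<in>{..<m}. v i = r} = k"
proof -
  have "(\<Prod>r\<in>fib_roots l. r ^ card {i\<in>{..<m}. v i = r}) =
        (\<Prod>r\<in>fib_roots l. \<Prod>i | i \<in> {..<m} \<and> v i = r. v i)"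
    by (intro prod.cong refl) simp
  also have "\<dots> = (\<Prod>i<m. v i)" using v(1) by (intro prod.group) auto
  finally show ?thesis using fib_roots_relation_constant[OF l] v(2) by simp
qed

section \<open>The meromorphic continuation\<close>

lemma holomorphic_gbinomial [holomorphic_intros]:
  "(\<lambda>s. (- s :: complex) gchoose k) holomorphic_on S"
  by (auto simp: gbinomial_pochhammer intro!: holomorphic_intros)

lemma norm_gbinomial_le:
  fixes s :: complex
  assumes "norm s \<le> S"
  shows "norm ((- s) gchoose k) \<le> pochhammer S k / fact k"
proof -
  have "norm (pochhammer s k) \<le> (\<Prod>i<k. S + real i)"
    unfolding pochhammer_prod prod_norm[symmetric] lessThan_atLeast0
    by (intro prod_mono) (use assms in \<open>auto intro: order.trans[OF norm_triangle_ineq]\<close>)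
  then show ?thesis
    by (simp add: gbinomial_pochhammer norm_mult norm_divide norm_power pochhammer_prod lessThan_atLeast0 divide_right_mono)
qed

text \<open>This is the binomial series of \<open>(1 - x) powr (- S)\<close> at
  \<open>x = 1 / 2\<close>.\<close>

lemma summable_pochhammer_half:
  "summable (\<lambda>k. pochhammer S k / fact k * (1 / 2 :: real) ^ k)"
proof -
  have "(\<lambda>k. ((- S) gchoose k) * (- (1 / 2)) ^ k) sums (1 + (- (1 / 2))) powr (- S)"
    by (rule gen_binomial_real) simp
  then have "summable (\<lambda>k. ((- S) gchoose k) * (- (1 / 2)) ^ k)" by (simp add: sums_iff)
  moreover have "((- S) gchoose k) * (- (1 / 2)) ^ k = pochhammer S k / fact k * (1 / 2) ^ k" for k
    by (simp add: gbinomial_pochhammer power_divide power_minus' flip: power_mult_distrib)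
  ultimately show ?thesis by simp
qed

definition binomial_rem :: "nat \<Rightarrow> complex \<Rightarrow> complex \<Rightarrow> complex" where
  "binomial_rem K s x = (1 + x) powr (- s) - (\<Sum>k<K. ((- s) gchoose k) * x ^ k)"

text \<open>Once \<open>x ^ K\<close> is taken out of the tail, the rest is majorized by its value
  for \<open>norm x = 1 / 2\<close>, uniformly in \<open>s\<close>.\<close>

lemma binomial_rem_bound:
  obtains C where "C \<ge> 0" "\<And>s x. norm s \<le> S \<Longrightarrow> norm x \<le> 1 / 2 \<Longrightarrow> norm (binomial_rem K s x) \<le> C * norm x ^ K"
proof
  \<comment> \<open>The absolute value keeps \<open>g\<close> nonnegative; for negative
    \<open>S\<close> the claim is vacuous.\<close>
  define g where "g k = pochhammer \<bar>S\<bar> k / fact k" for k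
  have g: "summable (\<lambda>k. g (k + K) * (1 / 2) ^ k)"
  proof -
    have "summable (\<lambda>k. 2 ^ K * (g (k + K) * (1 / 2) ^ (k + K)))"
      using summable_ignore_initial_segment[OF summable_pochhammer_half[of "\<bar>S\<bar>"], of K]
      by (intro summable_mult) (simp add: g_def)
    then show ?thesis by (simp add: power_add power_one_over)
  qed
  have g0: "g k \<ge> 0" for k by (auto simp: g_def pochhammer_prod intro!: divide_nonneg_nonneg prod_nonneg)
  define C where "C = (\<Sum>k. g (k + K) * (1 / 2) ^ k)"
  show "C \<ge> 0" unfolding C_def by (intro suminf_nonneg g) (simp add: g0)
  fix s x :: complex assume s: "norm s \<le> S" and x: "norm x \<le> 1 / 2"
  have "(\<lambda>k. ((- s) gchoose k) * x ^ k) sums (1 + x) powr (- s)"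
    using x by (intro gen_binomial_complex) auto
  then have "(\<lambda>k. ((- s) gchoose (k + K)) * x ^ (k + K)) sums binomial_rem K s x"
    unfolding binomial_rem_def by (rule sums_split_initial_segment)
  then have *: "binomial_rem K s x = (\<Sum>k. ((- s) gchoose (k + K)) * x ^ (k + K))"
    by (simp add: sums_iff)
  have "norm (((- s) gchoose (k + K)) * x ^ (k + K)) \<le> norm x ^ K * (g (k + K) * (1 / 2) ^ k)" for k
  proof -
    have "norm (((- s) gchoose (k + K)) * x ^ (k + K)) \<le> g (k + K) * ((1 / 2) ^ k * norm x ^ K)"
      unfolding norm_mult norm_power power_add[of "norm x"] 
      using norm_gbinomial_le[of s "\<bar>S\<bar>" "k + K"] s x g0
      by (intro mult_mono power_mono) (auto simp: g_def)
    then show ?thesis by (simp add: mult_ac)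
  qed
  then have "norm (binomial_rem K s x) \<le> (\<Sum>k. norm x ^ K * (g (k + K) * (1 / 2) ^ k))"
    unfolding * by (intro norm_suminf_le summable_mult g) auto
  also have "\<dots> = C * norm x ^ K" unfolding C_def using g by (subst suminf_mult) auto
  finally show "norm (binomial_rem K s x) \<le> C * norm x ^ K" .
qed

lemma binomial_rem_Suc:
  "binomial_rem K s x = binomial_rem (Suc K) s x + ((- s) gchoose K) * x ^ K"
  by (simp add: binomial_rem_def)

text \<open>At \<open>s = - m\<close> the series is the finite binomial theorem, with
  \<open>m + 1\<close> terms. The assumption excludes the convention
  \<open>0 powr 0 = 0\<close>.\<close>

lemma binomial_rem_minus_nat:
  assumes "1 + x \<noteq> 0"
  shows "binomial_rem (Suc m) (- of_nat m) x = 0"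
proof -
  have "(1 + x) ^ m = (\<Sum>k\<le>m. of_nat (m choose k) * x ^ k)"
    using binomial_ring[of x 1 m] by (simp add: add.commute)
  then show ?thesis
    using assms by (simp add: binomial_rem_def binomial_gbinomial lessThan_Suc_atMost)
qed

lemma holomorphic_binomial_rem [holomorphic_intros]:
  assumes "1 + x \<noteq> 0"
  shows "(\<lambda>s. binomial_rem K s x) holomorphic_on S"
  unfolding binomial_rem_def using assms by (intro holomorphic_intros)

section \<open>The dominant term and the relative error\<close>

locale fib_zeta =
  fixes l :: nat
  assumes l: "l \<ge> 2"
begin

definition \<alpha> :: real where "\<alpha> = fib_alpha l"
definition R where "R = fib_roots l"
definition R' where "R' = R - {of_real \<alpha>}"
text \<open>The coefficient turns out to be real; \<open>Re\<close> only gives it the real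
  type.\<close>

definition c where "c = Re (binet_coeff l (of_real \<alpha>))"
definition b where "b r = binet_coeff l r / of_real c"
definition \<epsilon> where "\<epsilon> n = (\<Sum>r\<in>R'. b r * (r / of_real \<alpha>) ^ n)"

lemma alpha_gt_1: "\<alpha> > 1"
  using fib_alpha[OF l] by (simp add: \<alpha>_def)

lemma fin_R [simp]: "finite R" "finite R'" by (simp_all add: R_def R'_def)

lemma alpha_in_R: "of_real \<alpha> \<in> R" using fib_alpha_root[OF l] by (simp add: R_def \<alpha>_def)

lemma norm_R': "r \<in> R' \<Longrightarrow> norm r < 1"
  using norm_fib_root_less_1[OF l, of r] by (simp add: R'_def R_def \<alpha>_def)

lemma R_nz: "r \<in> R \<Longrightarrow> r \<noteq> 0" using fib_root_nz[of l r] l by (simp add: R_def)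

text \<open>The coefficient is the limit of the nonnegative reals \<open>F n / \<alpha> ^ n\<close>,
  because all other roots contribute null sequences, and it is nonzero.\<close>

lemma c_pos: "c > 0" and binet_alpha: "binet_coeff l (of_real \<alpha>) = of_real c"
proof -
  let ?B = "binet_coeff l (of_real \<alpha>)"
  define y where "y n = real (gen_fib l (int n)) / \<alpha> ^ n" for n
  have y: "complex_of_real (y n) = ?B + (\<Sum>r\<in>R'. binet_coeff l r * (r / of_real \<alpha>) ^ n)" for n
  proof -
    have "complex_of_real (y n) = (\<Sum>r\<in>R. binet_coeff l r * (r / of_real \<alpha>) ^ n)"
      by (simp add: y_def binet[OF l] R_def sum_divide_distrib power_divide)
    then show ?thesis using alpha_in_R alpha_gt_1 by (simp add: R'_def sum.remove[of R])
  qed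
  have "(\<lambda>n. ?B + (\<Sum>r\<in>R'. binet_coeff l r * (r / of_real \<alpha>) ^ n)) \<longlonglongrightarrow> ?B + (\<Sum>r\<in>R'. binet_coeff l r * 0)"
    using norm_R' alpha_gt_1
    by (intro tendsto_intros LIMSEQ_power_zero) (force simp: norm_divide divide_simps)
  then have lim: "(\<lambda>n. complex_of_real (y n)) \<longlonglongrightarrow> ?B" by (simp add: y)
  have "y \<longlonglongrightarrow> c" using tendsto_Re[OF lim] by (simp add: c_def)
  then have "c \<ge> 0" by (rule LIMSEQ_le_const) (use alpha_gt_1 in \<open>auto simp: y_def\<close>)
  have "(\<lambda>n. 0) \<longlonglongrightarrow> Im ?B" using tendsto_Im[OF lim] by simp
  then have "Im ?B = 0" using LIMSEQ_unique tendsto_const by blast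
  then show eq: "?B = of_real c" by (simp add: c_def complex_eq_iff)
  moreover have "?B \<noteq> 0" using binet_coeff_nz[OF l] alpha_in_R by (simp add: R_def)
  ultimately show "c > 0" using \<open>c \<ge> 0\<close> by force
qed

lemma fib_eq: "of_nat (gen_fib l (int n)) = of_real (c * \<alpha> ^ n) * (1 + \<epsilon> n)"
proof -
  have "of_nat (gen_fib l (int n)) = of_real c * of_real \<alpha> ^ n + (\<Sum>r\<in>R'. binet_coeff l r * r ^ n)"
    unfolding binet[OF l] using alpha_in_R by (simp add: R'_def R_def sum.remove[of "fib_roots l"] binet_alpha)
  also have "(\<Sum>r\<in>R'. binet_coeff l r * r ^ n) = of_real (c * \<alpha> ^ n) * \<epsilon> n"
    using c_pos alpha_gt_1 unfolding \<epsilon>_def sum_distrib_left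
    by (intro sum.cong) (auto simp: b_def power_divide)
  finally show ?thesis by (simp add: algebra_simps)
qed

lemma eps_real:
  assumes "n > 0"
  shows "1 + \<epsilon> n = of_real (real (gen_fib l (int n)) / (c * \<alpha> ^ n))"
    and "real (gen_fib l (int n)) / (c * \<alpha> ^ n) > 0"
  using fib_eq[of n] c_pos alpha_gt_1 gen_fib_pos[OF l assms] by (auto simp: field_simps)

lemma eps_nz: "n > 0 \<Longrightarrow> 1 + \<epsilon> n \<noteq> 0"
  using eps_real[of n] by (metis of_real_eq_0_iff less_irrefl)

lemma norm_ratio_le: "r \<in> R' \<Longrightarrow> norm (r / of_real \<alpha>) \<le> 1 / \<alpha>"
  using norm_R'[of r] alpha_gt_1 by (simp add: norm_divide divide_right_mono)

lemma norm_eps_le: "norm (\<epsilon> n) \<le> (\<Sum>r\<in>R'. norm (b r)) * (1 / \<alpha>) ^ n"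
proof -
  have "norm (\<epsilon> n) \<le> (\<Sum>r\<in>R'. norm (b r) * (1 / \<alpha>) ^ n)"
    unfolding \<epsilon>_def
    by (rule sum_norm_le)
       (simp only: norm_mult norm_power, intro mult_left_mono power_mono norm_ratio_le norm_ge_zero)
  then show ?thesis by (simp add: sum_distrib_right)
qed

lemma eps_tendsto_0: "\<epsilon> \<longlonglongrightarrow> 0"
proof (rule Lim_null_comparison)
  show "\<forall>\<^sub>F n in sequentially. norm (\<epsilon> n) \<le> (\<Sum>r\<in>R'. norm (b r)) * (1 / \<alpha>) ^ n"
    by (simp add: norm_eps_le)
  show "(\<lambda>n. (\<Sum>r\<in>R'. norm (b r)) * (1 / \<alpha>) ^ n) \<longlonglongrightarrow> 0"
    using alpha_gt_1 by (intro tendsto_mult_right_zero LIMSEQ_power_zero) auto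
qed

definition X :: "complex \<Rightarrow> complex" where "X s = of_real \<alpha> powr (- s)"

lemma norm_X: "norm (X s) = \<alpha> powr (- Re s)"
  using alpha_gt_1 by (simp add: X_def norm_powr_real_powr)

lemma X_minus_nat: "X (- of_nat m) = of_real \<alpha> ^ m"
  using alpha_gt_1 by (simp add: X_def)

lemma holomorphic_X [holomorphic_intros]: "X holomorphic_on S"
  unfolding X_def using alpha_gt_1 by (intro holomorphic_intros) auto

text \<open>Positive real factors can be split off from a complex power without a change of
  branch.\<close>

lemma fib_powr:
  assumes "n > 0"
  shows "of_nat (gen_fib l (int n)) powr (- s) = of_real c powr (- s) * (X s ^ n * (1 + \<epsilon> n) powr (- s))"
proof -
  have pw: "(of_real \<alpha> ^ n) powr (- s) = X s ^ n" for n
  proof (induction n)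
    case (Suc n)
    have "(of_real \<alpha> * of_real \<alpha> ^ n) powr (- s) = of_real \<alpha> powr (- s) * (of_real \<alpha> ^ n) powr (- s)"
      using alpha_gt_1 by (intro powr_times_real_left) auto
    then have "(of_real \<alpha> * of_real \<alpha> ^ n) powr (- s) = X s * X s ^ n"
      unfolding Suc.IH X_def .
    then show ?case by (simp only: power_Suc)
  qed simp
  have "of_nat (gen_fib l (int n)) powr (- s) = (of_real c * (of_real (\<alpha> ^ n) * (1 + \<epsilon> n))) powr (- s)"
    by (simp add: fib_eq mult.assoc)
  also have "\<dots> = of_real c powr (- s) * (of_real (\<alpha> ^ n) powr (- s) * (1 + \<epsilon> n) powr (- s))"
    using c_pos alpha_gt_1 by (simp add: powr_times_real_left)
  finally show ?thesis by (simp add: pw)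
qed

text \<open>
  \<open>H k\<close> is the closed form of the Dirichlet series with terms
  \<open>\<alpha> powr (- n s) * \<epsilon> n ^ k\<close>, obtained by expanding \<open>\<epsilon> n ^ k\<close> over all tuples of
  non-dominant roots.
\<close>

definition W where "W k = ({..<k} \<rightarrow>\<^sub>E R')" for k :: nat
definition cf where "cf k w = (\<Prod>i<k. b (w i))" for k :: nat and w :: "nat \<Rightarrow> complex"
definition \<Lambda> where "\<Lambda> k w = (\<Prod>i<k. w i / of_real \<alpha>)" for k :: nat and w :: "nat \<Rightarrow> complex"

definition H where "H k s = (\<Sum>w\<in>W k. cf k w * (X s * \<Lambda> k w / (1 - X s * \<Lambda> k w)))"

lemma fin_W [simp]: "finite (W k)" by (auto simp: W_def intro: finite_PiE)

lemma eps_power: "\<epsilon> n ^ k = (\<Sum>w\<in>W k. cf k w * \<Lambda> k w ^ n)"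
proof -
  have "\<epsilon> n ^ k = (\<Prod>i<k. \<Sum>r\<in>R'. b r * (r / of_real \<alpha>) ^ n)" by (simp add: \<epsilon>_def)
  also have "\<dots> = (\<Sum>w\<in>W k. \<Prod>i<k. b (w i) * (w i / of_real \<alpha>) ^ n)"
    unfolding W_def by (subst prod_sum_PiE) auto
  also have "\<dots> = (\<Sum>w\<in>W k. cf k w * \<Lambda> k w ^ n)"
    by (simp add: cf_def \<Lambda>_def prod.distrib prod_power_distrib)
  finally show ?thesis .
qed

lemma norm_Lambda_le:
  assumes "w \<in> W k" shows "norm (\<Lambda> k w) \<le> (1 / \<alpha>) ^ k"
proof -
  have "norm (\<Lambda> k w) = (\<Prod>i<k. norm (w i / of_real \<alpha>))" by (simp add: \<Lambda>_def prod_norm)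
  also have "\<dots> \<le> (\<Prod>i<k. 1 / \<alpha>)"
    by (intro prod_mono conjI norm_ge_zero norm_ratio_le) (use assms in \<open>auto simp: W_def\<close>)
  finally show ?thesis by simp
qed

text \<open>Each of the \<open>k\<close> factors of \<Lambda> has norm at most
  \<open>1 / \<alpha>\<close>, so the ratio is bounded by a power of \<alpha> with negative
  exponent.\<close>

lemma norm_X_Lambda_less_1:
  assumes "w \<in> W k" "Re s > - real k" shows "norm (X s * \<Lambda> k w) < 1"
proof -
  have "norm (X s * \<Lambda> k w) \<le> \<alpha> powr (- Re s) * (1 / \<alpha>) ^ k"
    unfolding norm_mult norm_X using norm_Lambda_le[OF assms(1)] by (intro mult_left_mono) auto
  also have "\<dots> = \<alpha> powr (- Re s - real k)"
    using alpha_gt_1 by (simp add: powr_diff powr_realpow power_one_over divide_simps)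
  also have "\<dots> < \<alpha> powr 0" using alpha_gt_1 assms(2) by (intro powr_less_mono) auto
  finally show ?thesis using alpha_gt_1 by simp
qed

lemma H_sums:
  assumes "Re s > - real k"
  shows "(\<lambda>n. X s ^ Suc n * \<epsilon> (Suc n) ^ k) sums H k s"
proof -
  have "(\<lambda>n. \<Sum>w\<in>W k. cf k w * (X s * \<Lambda> k w * (X s * \<Lambda> k w) ^ n)) sums
    (\<Sum>w\<in>W k. cf k w * (X s * \<Lambda> k w * (1 / (1 - X s * \<Lambda> k w))))"
    using norm_X_Lambda_less_1[OF _ assms] by (intro sums_sum sums_mult geometric_sums) auto
  also have "(\<lambda>n. \<Sum>w\<in>W k. cf k w * (X s * \<Lambda> k w * (X s * \<Lambda> k w) ^ n)) =
      (\<lambda>n. X s ^ Suc n * \<epsilon> (Suc n) ^ k)"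
    by (simp add: eps_power sum_distrib_left power_mult_distrib mult_ac fun_eq_iff)
  finally show ?thesis by (simp add: H_def)
qed

lemma analytic_X: "X analytic_on S"
  by (rule analytic_on_subset[of _ UNIV]) (auto simp: analytic_on_open intro!: holomorphic_intros)

lemma meromorphic_H: "H k meromorphic_on S"
  unfolding H_def[abs_def]
  by (intro meromorphic_on_sum meromorphic_on_mult meromorphic_on_divide meromorphic_on_diff
      meromorphic_on_const analytic_on_imp_meromorphic_on[OF analytic_X])

section \<open>The remainder series and the continuation\<close>

definition rem_sum where "rem_sum K s = (\<Sum>n. X s ^ Suc n * binomial_rem K s (\<epsilon> (Suc n)))"

text \<open>The majorant is uniform in \<open>s\<close>, as the M-test requires. The first terms are
  left out because the bound for the binomial remainder needs \<open>\<epsilon> n\<close> to be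
  small.\<close>

lemma rem_bound:
  assumes "\<sigma> > - real K"
  obtains M N where "summable M"
    "\<And>s n. norm s \<le> S \<Longrightarrow> Re s \<ge> \<sigma> \<Longrightarrow> n \<ge> N \<Longrightarrow>
       norm (X s ^ Suc n * binomial_rem K s (\<epsilon> (Suc n))) \<le> M n"
proof -
  obtain C where C: "C \<ge> 0" "\<And>s x. norm s \<le> S \<Longrightarrow> norm x \<le> 1 / 2 \<Longrightarrow> norm (binomial_rem K s x) \<le> C * norm x ^ K"
    using binomial_rem_bound[of S K] by metis
  have "\<forall>\<^sub>F n in sequentially. dist (\<epsilon> n) 0 < 1 / 2" by (rule tendstoD[OF eps_tendsto_0]) simp
  then obtain N where N: "\<And>n. n \<ge> N \<Longrightarrow> norm (\<epsilon> n) < 1 / 2" by (auto simp: eventually_sequentially)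
  define B where "B = (\<Sum>r\<in>R'. norm (b r))"
  have B: "B \<ge> 0" by (simp add: B_def sum_nonneg)
  \<comment> \<open>One factor bounds \<open>X s\<close>, the other the decay of the
    \<open>K\<close>-th power of the error.\<close>
  define q where "q = \<alpha> powr (- \<sigma>) * (1 / \<alpha>) ^ K"
  have "q = \<alpha> powr (- \<sigma> - real K)"
    using alpha_gt_1 by (simp add: q_def powr_diff powr_realpow power_one_over divide_simps)
  also have "\<dots> < \<alpha> powr 0" using alpha_gt_1 assms by (intro powr_less_mono) auto
  finally have q: "q < 1" "q \<ge> 0" using alpha_gt_1 by (simp_all add: q_def)
  show ?thesis
  proof
    show "summable (\<lambda>n. C * B ^ K * q ^ Suc n)"
      using q by (intro summable_mult) (simp add: summable_geometric summable_Suc_iff del: power_Suc)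
    fix s n assume s: "norm s \<le> S" "Re s \<ge> \<sigma>" "n \<ge> N"
    have "norm (binomial_rem K s (\<epsilon> (Suc n))) \<le> C * norm (\<epsilon> (Suc n)) ^ K"
      using s N[of "Suc n"] by (intro C) auto
    also have "\<dots> \<le> C * (B * (1 / \<alpha>) ^ Suc n) ^ K"
      unfolding B_def using C(1) by (intro mult_left_mono power_mono norm_eps_le) auto
    finally have "norm (binomial_rem K s (\<epsilon> (Suc n))) \<le> C * (B * (1 / \<alpha>) ^ Suc n) ^ K" .
    moreover have "norm (X s ^ Suc n) \<le> (\<alpha> powr (- \<sigma>)) ^ Suc n"
      unfolding norm_power norm_X using s alpha_gt_1 by (intro power_mono powr_mono) auto
    ultimately have "norm (X s ^ Suc n * binomial_rem K s (\<epsilon> (Suc n)))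
        \<le> (\<alpha> powr (- \<sigma>)) ^ Suc n * (C * (B * (1 / \<alpha>) ^ Suc n) ^ K)"
      unfolding norm_mult by (intro mult_mono) auto
    also have "\<dots> = C * B ^ K * q ^ Suc n"
      unfolding q_def power_mult_distrib power_mult[symmetric] by (simp only: mult_ac)
    finally show "norm (X s ^ Suc n * binomial_rem K s (\<epsilon> (Suc n))) \<le> C * B ^ K * q ^ Suc n" .
  qed
qed

lemma summable_rem:
  assumes "Re s > - real K"
  shows "summable (\<lambda>n. X s ^ Suc n * binomial_rem K s (\<epsilon> (Suc n)))"
proof -
  obtain M N where "summable M" "\<And>n. n \<ge> N \<Longrightarrow> norm (X s ^ Suc n * binomial_rem K s (\<epsilon> (Suc n))) \<le> M n"
    using rem_bound[OF assms, of "norm s"] by (metis order_refl)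
  then show ?thesis by (rule summable_comparison_test'[of M N])
qed

lemma rem_sum_Suc:
  assumes "Re s > - real K"
  shows "rem_sum K s = rem_sum (Suc K) s + ((- s) gchoose K) * H K s"
proof -
  have "(\<lambda>n. X s ^ Suc n * binomial_rem (Suc K) s (\<epsilon> (Suc n)) + ((- s) gchoose K) * (X s ^ Suc n * \<epsilon> (Suc n) ^ K))
     sums (rem_sum (Suc K) s + ((- s) gchoose K) * H K s)"
    unfolding rem_sum_def using assms
    by (intro sums_add sums_mult H_sums summable_sums summable_rem) auto
  also have "(\<lambda>n. X s ^ Suc n * binomial_rem (Suc K) s (\<epsilon> (Suc n)) + ((- s) gchoose K) * (X s ^ Suc n * \<epsilon> (Suc n) ^ K))
     = (\<lambda>n. X s ^ Suc n * binomial_rem K s (\<epsilon> (Suc n)))"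
    by (subst (2) binomial_rem_Suc) (simp add: algebra_simps)
  finally show ?thesis by (simp add: rem_sum_def sums_iff)
qed

lemma rem_sum_holomorphic: "rem_sum K holomorphic_on {s. Re s > - real K}"
proof (rule holomorphic_uniform_sequence)
  show "open {s. - real K < Re s}" by (rule open_halfspace_Re_gt)
  let ?f = "\<lambda>n s. X s ^ Suc n * binomial_rem K s (\<epsilon> (Suc n))"
  show "(\<lambda>s. \<Sum>n<N. ?f n s) holomorphic_on {s. - real K < Re s}" for N
    using eps_nz by (intro holomorphic_intros) auto
  fix s assume s: "s \<in> {s. - real K < Re s}"
  \<comment> \<open>Half the distance to the boundary line keeps the closed disc inside the
    half-plane.\<close>
  define d where "d = (Re s + real K) / 2"
  have d: "d > 0" "Re s - d > - real K" using s by (auto simp: d_def field_simps)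
  have cb: "norm z \<le> norm s + d" "Re z \<ge> Re s - d" if "z \<in> cball s d" for z
  proof -
    have "norm (s - z) \<le> d" using that by (simp add: dist_norm)
    then show "Re z \<ge> Re s - d" using complex_Re_le_cmod[of "s - z"] by simp
    show "norm z \<le> norm s + d" using \<open>norm (s - z) \<le> d\<close> norm_triangle_sub[of z s] by (simp add: norm_minus_commute)
  qed
  obtain M N where M: "summable M" "\<And>z n. norm z \<le> norm s + d \<Longrightarrow> Re z \<ge> Re s - d \<Longrightarrow> n \<ge> N \<Longrightarrow>
       norm (?f n z) \<le> M n"
    using rem_bound[OF d(2), of "norm s + d"] by metis
  have "uniform_limit (cball s d) (\<lambda>n z. \<Sum>i<n. ?f i z) (\<lambda>z. \<Sum>i. ?f i z) sequentially"
    by (rule Weierstrass_m_test_ev[OF _ M(1)])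
       (auto simp: eventually_sequentially intro!: exI[of _ N] M(2) cb simp del: power_Suc)
  then show "\<exists>d>0. cball s d \<subseteq> {s. - real K < Re s} \<and>
     uniform_limit (cball s d) (\<lambda>N z. \<Sum>n<N. ?f n z) (rem_sum K) sequentially"
    unfolding rem_sum_def[abs_def] using d cb(2) by (intro exI[of _ d]) force
qed

text \<open>
  The binomial series is cut off after \<open>K\<close> terms, which gives the continuation to
  \<open>Re s > - K\<close>; the cut-off term moves between \<open>H K\<close> and the remainder as \<open>K\<close> varies.
\<close>

definition ZK where
  "ZK K s = of_real c powr (- s) * ((\<Sum>k<K. ((- s) gchoose k) * H k s) + rem_sum K s)"

lemma ZK_Suc: "Re s > - real K \<Longrightarrow> ZK (Suc K) s = ZK K s"
  using rem_sum_Suc[of K s] by (simp add: ZK_def)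

lemma ZK_mono: "K \<le> K' \<Longrightarrow> Re s > - real K \<Longrightarrow> ZK K' s = ZK K s"
  by (induction rule: dec_induct) (auto simp: ZK_Suc)

text \<open>All admissible cut-offs agree, so one chosen from \<open>s\<close> glues the functions
  \<open>ZK K\<close> together; \<open>Suc\<close> makes \<open>Re s > - K\<close> strict.\<close>

definition Z where "Z s = ZK (Suc (nat \<lceil>\<bar>Re s\<bar>\<rceil>)) s"

lemma Z_eq_ZK:
  assumes "Re s > - real K" shows "Z s = ZK K s"
proof -
  define k where "k = Suc (nat \<lceil>\<bar>Re s\<bar>\<rceil>)"
  have "Re s > - real k" unfolding k_def by linarith
  then have "ZK (max k K) s = ZK k s" "ZK (max k K) s = ZK K s"
    using assms by (auto intro: ZK_mono)
  then show ?thesis by (simp add: Z_def k_def)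
qed

lemma eventually_Z_eq_ZK:
  assumes "Re s > - real K" shows "\<forall>\<^sub>F z in nhds s. Z z = ZK K z"
proof -
  have "\<forall>\<^sub>F z in nhds s. z \<in> {z. Re z > - real K}"
    using assms by (intro eventually_nhds_in_open open_halfspace_Re_gt) auto
  then show ?thesis by eventually_elim (simp add: Z_eq_ZK)
qed

lemma rem_sum_analytic: "Re s > - real K \<Longrightarrow> rem_sum K analytic_on {s}"
  using rem_sum_holomorphic[of K] open_halfspace_Re_gt[of "- real K"]
  by (auto simp: analytic_at)

lemma analytic_gbinomial: "(\<lambda>s::complex. (- s) gchoose k) analytic_on S"
  by (rule analytic_on_subset[of _ UNIV]) (auto simp: analytic_on_open intro!: holomorphic_intros)

lemma analytic_c_powr: "(\<lambda>s. complex_of_real c powr (- s)) analytic_on S"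
  by (rule analytic_on_subset[of _ UNIV]) (use c_pos in \<open>auto simp: analytic_on_open intro!: holomorphic_intros\<close>)

lemma Z_meromorphic: "Z meromorphic_on UNIV"
proof (subst meromorphic_on_meromorphic_at, intro ballI)
  fix s
  define K where "K = Suc (nat \<lceil>\<bar>Re s\<bar>\<rceil>)"
  have K: "Re s > - real K" unfolding K_def by linarith
  have "ZK K meromorphic_on {s}"
    unfolding ZK_def[abs_def]
    by (intro meromorphic_intros meromorphic_H analytic_on_imp_meromorphic_on rem_sum_analytic K
          analytic_gbinomial analytic_c_powr)
  moreover have "\<forall>\<^sub>F z in at s. Z z = ZK K z"
    using eventually_Z_eq_ZK[OF K] by (auto simp: eventually_at_filter elim: eventually_mono)
  ultimately show "Z meromorphic_on {s}"
    using meromorphic_on_cong[of "{s}" Z "ZK K" "{s}"] by blast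
qed

text \<open>With cut-off \<open>0\<close> nothing is split off, and the remainder series is the
  original series up to the factor \<open>of_real c powr (- s)\<close>.\<close>

lemma Z_eq_series:
  assumes "Re s > 0" shows "Z s = gen_fib_zeta_series l s"
proof -
  have s: "Re s > - real 0" using assms by simp
  have "gen_fib_zeta_series l s = (\<Sum>n. of_real c powr (- s) * (X s ^ Suc n * binomial_rem 0 s (\<epsilon> (Suc n))))"
    unfolding gen_fib_zeta_series_def
    using fib_powr[of "Suc _" s] by (simp add: binomial_rem_def add.commute)
  also have "\<dots> = ZK 0 s"
    using summable_rem[OF s] by (subst suminf_mult) (auto simp: ZK_def rem_sum_def)
  finally show ?thesis using Z_eq_ZK[OF s] by simp
qed

text \<open>Singularities can only come from the denominators in the finitely many
  \<open>H k\<close> with \<open>k < K\<close>.\<close>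

lemma Z_analytic:
  assumes "Re s > - real K" "\<And>k w. k < K \<Longrightarrow> w \<in> W k \<Longrightarrow> X s * \<Lambda> k w \<noteq> 1"
  shows "Z analytic_on {s}"
proof -
  have "H k analytic_on {s}" if "k < K" for k
    unfolding H_def[abs_def] using assms(2)[OF that]
    by (intro analytic_intros analytic_X) auto
  then have "ZK K analytic_on {s}"
    unfolding ZK_def[abs_def]
    by (intro analytic_intros rem_sum_analytic assms analytic_gbinomial analytic_c_powr) auto
  then show ?thesis using analytic_at_cong[OF eventually_Z_eq_ZK[OF assms(1)] refl] by simp
qed

end

section \<open>Values at negative integers\<close>

text \<open>
  The regularized tails \<open>S i\<close> satisfy a linear recurrence with rational coefficients, whose
  characteristic polynomial does not vanish at \<open>1\<close>, and differ from \<open>S 0\<close> by rational numbers.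
\<close>

lemma regularized_sum_Rats:
  fixes d \<nu> :: "'i \<Rightarrow> complex" and \<mu> :: "'j \<Rightarrow> complex"
  assumes fin: "finite V"
    and rat: "\<And>n. (\<Sum>w\<in>W. d w * \<nu> w ^ Suc n) \<in> \<rat>" "\<And>n. (\<Sum>v\<in>V. \<mu> v ^ n) \<in> \<rat>"
    and \<mu>: "\<And>v. v \<in> V \<Longrightarrow> \<mu> v \<noteq> 1" and \<nu>: "\<And>w. w \<in> W \<Longrightarrow> \<nu> w \<noteq> 0 \<and> \<nu> w \<in> \<mu> ` V"
  shows "(\<Sum>w\<in>W. d w * (\<nu> w / (1 - \<nu> w))) \<in> \<rat>"
proof -
  define E where "E = (\<Prod>v\<in>V. [:1, - \<mu> v:])"
  define D where "D = degree E"
  \<comment> \<open>This is the regularized value of the sum of \<open>u n\<close> over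
    \<open>n \<ge> i\<close>; the claim concerns \<open>S 0\<close>.\<close>
  define S where "S i = (\<Sum>w\<in>W. d w * (\<nu> w ^ Suc i / (1 - \<nu> w)))" for i
  define u where "u n = (\<Sum>w\<in>W. d w * \<nu> w ^ Suc n)" for n
  have \<nu>1: "\<nu> w \<noteq> 1" if "w \<in> W" for w using \<nu>[OF that] \<mu> by auto
  have u: "u n = S n - S (Suc n)" for n
    unfolding u_def S_def sum_subtractf[symmetric]
  proof (intro sum.cong refl)
    fix w assume "w \<in> W"
    then have "1 - \<nu> w \<noteq> 0" using \<nu>1 by auto
    moreover have "\<nu> w ^ Suc n / (1 - \<nu> w) - \<nu> w ^ Suc (Suc n) / (1 - \<nu> w) =
        \<nu> w ^ Suc n * (1 - \<nu> w) / (1 - \<nu> w)"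
      unfolding diff_divide_distrib[symmetric] by (simp add: algebra_simps)
    ultimately show "d w * \<nu> w ^ Suc n = d w * (\<nu> w ^ Suc n / (1 - \<nu> w)) - d w * (\<nu> w ^ Suc (Suc n) / (1 - \<nu> w))"
      unfolding right_diff_distrib[symmetric] by simp
  qed
  have S: "S i = S 0 - (\<Sum>n<i. u n)" for i
  proof (induction i)
    case (Suc i)
    have "S (Suc i) = S i - u i" by (simp add: u)
    then show ?case by (simp only: Suc.IH sum.lessThan_Suc diff_diff_eq)
  qed simp
  \<comment> \<open>The reversal of \<open>E\<close> has the numbers \<open>\<mu> v\<close> among
    its zeros, and every \<open>\<nu> w\<close> is one of them.\<close>
  have Ew: "(\<Sum>i\<le>D. coeff E i * \<nu> w ^ (D - i)) = 0" if "w \<in> W" for w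
  proof -
    obtain v where v: "v \<in> V" "\<nu> w = \<mu> v" using \<nu>[OF \<open>w \<in> W\<close>] by auto
    have nz: "\<nu> w \<noteq> 0" using \<nu>[OF \<open>w \<in> W\<close>] by simp
    have "(\<Sum>i\<le>D. coeff E i * \<nu> w ^ (D - i)) = \<nu> w ^ D * poly E (inverse (\<nu> w))"
      unfolding poly_altdef D_def[symmetric] sum_distrib_left
      by (intro sum.cong refl) (use nz in \<open>simp add: power_diff power_inverse divide_inverse mult_ac\<close>)
    also have "poly E (inverse (\<nu> w)) = 0"
      using fin v nz by (auto simp: E_def poly_prod intro!: prod_zero bexI[of _ v])
    finally show ?thesis by simp
  qed
  have "(\<Sum>i\<le>D. coeff E i * S (D - i)) = (\<Sum>w\<in>W. d w * (\<nu> w / (1 - \<nu> w)) * (\<Sum>i\<le>D. coeff E i * \<nu> w ^ (D - i)))"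
    unfolding S_def sum_distrib_left by (subst sum.swap) (simp add: mult_ac)
  also have "\<dots> = 0" using Ew by simp
  finally have "(\<Sum>i\<le>D. coeff E i * (S 0 - (\<Sum>n<D - i. u n))) = 0" by (simp only: S[symmetric])
  then have "(\<Sum>i\<le>D. coeff E i) * S 0 = (\<Sum>i\<le>D. coeff E i * (\<Sum>n<D - i. u n))"
    by (simp add: right_diff_distrib sum_subtractf sum_distrib_right)
  moreover have E1: "(\<Sum>i\<le>D. coeff E i) = (\<Prod>v\<in>V. 1 - \<mu> v)"
  proof -
    have "(\<Sum>i\<le>D. coeff E i) = poly E 1" by (simp add: poly_altdef D_def)
    then show ?thesis by (simp add: E_def poly_prod)
  qed
  moreover have "(\<Prod>v\<in>V. 1 - \<mu> v) \<noteq> 0" using fin \<mu> by (auto simp: prod_zero_iff)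
  ultimately have "S 0 = (\<Sum>i\<le>D. coeff E i * (\<Sum>n<D - i. u n)) / (\<Sum>i\<le>D. coeff E i)"
    by (simp add: field_simps)
  moreover have "coeff E i \<in> \<rat>" for i
    unfolding E_def by (rule coeff_prod_linear_Rats[OF fin rat(2)])
  moreover have "u n \<in> \<rat>" for n unfolding u_def by (rule rat(1))
  ultimately have "S 0 \<in> \<rat>" by (simp only:) (intro Rats_divide Rats_sum Rats_mult)
  then show ?thesis by (simp add: S_def)
qed

text \<open>The identity theorem gives equality near every point except possibly at the point
  itself, where the normalization of values takes over.\<close>

lemma meromorphic_eqI:
  assumes f: "f nicely_meromorphic_on UNIV" and g: "g nicely_meromorphic_on UNIV"
    and S: "open S" "S \<noteq> {}" "\<And>z. z \<in> S \<Longrightarrow> f z = g z"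
  shows "f = g"
proof
  fix z
  have fm: "f meromorphic_on UNIV" and gm: "g meromorphic_on UNIV"
    using f g by (auto simp: nicely_meromorphic_on_def)
  \<comment> \<open>The difference itself need not be normalized, for instance where poles
    cancel.\<close>
  define h where "h = remove_sings (\<lambda>z. f z - g z)"
  have "(\<lambda>z. f z - g z) meromorphic_on UNIV" using fm gm by (intro meromorphic_intros)
  then have hm: "h nicely_meromorphic_on UNIV" and
    ev: "\<forall>\<^sub>\<approx>z\<in>UNIV. h z = f z - g z"
    unfolding h_def using remove_sings_nicely_meromorphic eventually_remove_sings_eq by blast+
  obtain x where x: "x \<in> S" using S(2) by auto
  have ev_at: "\<forall>\<^sub>F w in at z. h w = f w - g w" for z
    using ev by (simp add: eventually_cosparse_open_eq)
  have "\<forall>\<^sub>F w in at x. w \<in> S" using S(1) x by (rule eventually_at_in_open')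
  then have "\<forall>\<^sub>F w in at x. h w = 0" using ev_at[of x] by eventually_elim (simp add: S(3))
  then have "\<exists>\<^sub>F w in at x. h w = 0" by (rule eventually_frequently[rotated]) simp
  then have h0: "h w = 0" for w
    by (rule frequently_eq_meromorphic_imp_constant[OF _ hm open_UNIV connected_UNIV UNIV_I UNIV_I])
  have fg: "\<forall>\<^sub>F w in at z. f w = g w" using ev_at[of z] by eventually_elim (simp add: h0)
  then have pole: "is_pole f z \<longleftrightarrow> is_pole g z" by (intro is_pole_cong) auto
  have cases: "(is_pole f z \<and> f z = 0) \<or> f \<midarrow>z\<rightarrow> f z" "(is_pole g z \<and> g z = 0) \<or> g \<midarrow>z\<rightarrow> g z"
    using f g by (auto simp: nicely_meromorphic_on_def)
  show "f z = g z"
  proof (cases "is_pole f z")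
    case True
    then have "\<not> f \<midarrow>z\<rightarrow> c" "\<not> g \<midarrow>z\<rightarrow> c" for c
      using pole not_tendsto_and_filterlim_at_infinity[OF at_neq_bot] unfolding is_pole_def by blast+
    then show ?thesis using cases by auto
  next
    case False
    then have "f \<midarrow>z\<rightarrow> f z" "g \<midarrow>z\<rightarrow> g z" using cases pole by auto
    moreover from this(1) have "g \<midarrow>z\<rightarrow> f z" using fg by (rule Lim_transform_eventually)
    ultimately show ?thesis using LIM_unique by blast
  qed
qed

section \<open>The zeta function at regular and singular negative integers\<close>

context fib_zeta
begin

text \<open>Removing the singularities of \<open>Z\<close> normalizes its values, and agreement on a
  half-plane makes the function unique.\<close>

lemma gen_fib_zeta_eq: "gen_fib_zeta l = remove_sings Z"
  unfolding gen_fib_zeta_def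
proof (rule the_equality)
  have an: "Z analytic_on {s}" if "Re s > 0" for s
    using that by (intro Z_analytic[of 0]) auto
  have nice: "remove_sings Z nicely_meromorphic_on UNIV"
    using Z_meromorphic by (rule remove_sings_nicely_meromorphic)
  moreover have eq: "remove_sings Z s = gen_fib_zeta_series l s" if "Re s > 0" for s
    using an[OF that] that by (simp add: Z_eq_series)
  ultimately show "remove_sings Z nicely_meromorphic_on UNIV \<and>
      (\<forall>s. 0 < Re s \<longrightarrow> remove_sings Z s = gen_fib_zeta_series l s)" by blast
  fix f assume f: "f nicely_meromorphic_on UNIV \<and> (\<forall>s. 0 < Re s \<longrightarrow> f s = gen_fib_zeta_series l s)"
  have "{s. 0 < Re s} \<noteq> {}" by (auto intro: exI[of _ 1])
  then show "f = remove_sings Z"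
    using f nice eq open_halfspace_Re_gt[of 0]
    by (intro meromorphic_eqI[of _ _ "{s. 0 < Re s}"]) auto
qed

text \<open>Copies of the dominant root fill a tuple up to length \<open>m\<close>, so that the
  terms in the expansion of the \<open>m\<close>-th power correspond to \<open>m\<close>-tuples of
  roots.\<close>

definition pad :: "nat \<Rightarrow> nat \<Rightarrow> (nat \<Rightarrow> complex) \<Rightarrow> nat \<Rightarrow> complex" where
  "pad m k w = restrict (\<lambda>i. if i < k then w i else of_real \<alpha>) {..<m}"

lemma pad_in: "k \<le> m \<Longrightarrow> w \<in> W k \<Longrightarrow> pad m k w \<in> {..<m} \<rightarrow>\<^sub>E R"
  using alpha_in_R by (auto simp: pad_def W_def R'_def PiE_iff)

lemma prod_pad:
  assumes "k \<le> m"
  shows "(\<Prod>i<m. pad m k w i) = X (- of_nat m) * \<Lambda> k w"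
proof -
  have "(\<Prod>i<m. pad m k w i) = (\<Prod>i\<in>{..<k} \<union> {k..<m}. if i < k then w i else of_real \<alpha>)"
    using assms by (intro prod.cong) (auto simp: pad_def)
  also have "\<dots> = (\<Prod>i<k. w i) * of_real \<alpha> ^ (m - k)"
    by (subst prod.union_disjoint) auto
  also have "\<dots> = X (- of_nat m) * \<Lambda> k w"
    using assms alpha_gt_1 by (simp add: X_minus_nat \<Lambda>_def prod_dividef power_diff)
  finally show ?thesis .
qed

text \<open>The remainder vanishes at \<open>- m\<close>, and the finitely many terms left form the
  regularized sum of \<open>F n ^ m\<close>; all products of \<open>m\<close> roots serve as the
  zeros of the rational polynomial.\<close>

lemma regular_value_Rats:
  assumes reg: "\<And>v. v \<in> {..<m} \<rightarrow>\<^sub>E R \<Longrightarrow> (\<Prod>i<m. v i) \<noteq> 1"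
  shows "Z (- of_nat m) \<in> \<rat>"
proof -
  define V where "V = ({..<m} \<rightarrow>\<^sub>E R)"
  define W' where "W' = (SIGMA k:{..m}. W k)"
  define d where "d = (\<lambda>(k, w). of_real c ^ m * of_nat (m choose k) * cf k w)"
  define \<nu> where "\<nu> = (\<lambda>(k, w). X (- of_nat m) * \<Lambda> k w)"
  have gb: "(of_nat m gchoose k) = (of_nat (m choose k) :: complex)" for k
    by (simp add: binomial_gbinomial)
  have "binomial_rem (Suc m) (- of_nat m) (\<epsilon> (Suc n)) = 0" for n
    using eps_nz[of "Suc n"] by (intro binomial_rem_minus_nat) auto
  then have "Z (- of_nat m) = of_real c ^ m * (\<Sum>k\<le>m. of_nat (m choose k) * H k (- of_nat m))"
    using Z_eq_ZK[of "Suc m" "- of_nat m"] c_pos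
    by (simp add: ZK_def rem_sum_def gb lessThan_Suc_atMost)
  also have "\<dots> = (\<Sum>x\<in>W'. d x * (\<nu> x / (1 - \<nu> x)))"
    by (simp add: W'_def d_def \<nu>_def H_def sum_distrib_left sum.Sigma case_prod_unfold mult_ac)
  also have "\<dots> \<in> \<rat>"
  proof (rule regularized_sum_Rats)
    show "finite V" by (auto simp: V_def intro: finite_PiE)
    \<comment> \<open>By Binet's formula this sum is the natural number
      \<open>F (n + 1) ^ m\<close>.\<close>
    show "(\<Sum>x\<in>W'. d x * \<nu> x ^ Suc n) \<in> \<rat>" for n
    proof -
      have "of_nat (gen_fib l (int (Suc n))) ^ m =
          of_real c ^ m * (X (- of_nat m)) ^ Suc n * (1 + \<epsilon> (Suc n)) ^ m"
        by (simp only: fib_eq X_minus_nat of_real_mult of_real_power power_mult_distrib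
            power_mult[symmetric] mult.commute[of m])
      also have "(1 + \<epsilon> (Suc n)) ^ m = (\<Sum>k\<le>m. of_nat (m choose k) * \<epsilon> (Suc n) ^ k)"
        using binomial_ring[of "\<epsilon> (Suc n)" 1 m] by (simp add: add.commute)
      also have "of_real c ^ m * (X (- of_nat m)) ^ Suc n * \<dots> = (\<Sum>x\<in>W'. d x * \<nu> x ^ Suc n)"
        by (simp add: W'_def d_def \<nu>_def eps_power sum_distrib_left sum.Sigma case_prod_unfold
            power_mult_distrib mult_ac del: power_Suc)
      finally show ?thesis by (metis Rats_of_nat Rats_power)
    qed
    show "(\<Sum>v\<in>V. (\<Prod>i<m. v i) ^ n) \<in> \<rat>" for n
    proof -
      have "(\<Sum>v\<in>V. (\<Prod>i<m. v i) ^ n) = (\<Prod>i<m. \<Sum>r\<in>R. r ^ n)"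
        unfolding V_def by (subst prod_sum_PiE) (auto simp: prod_power_distrib)
      then show ?thesis
        using fib_power_sum_Ints[OF l, of n] by (auto simp: R_def intro!: Rats_power elim!: Ints_cases)
    qed
    show "(\<Prod>i<m. v i) \<noteq> 1" if "v \<in> V" for v using reg that by (simp add: V_def)
    show "\<nu> x \<noteq> 0 \<and> \<nu> x \<in> (\<lambda>v. \<Prod>i<m. v i) ` V" if "x \<in> W'" for x
    proof -
      from that obtain k w where x: "x = (k, w)" "k \<le> m" "w \<in> W k" by (auto simp: W'_def)
      have "pad m k w \<in> V" using x pad_in by (simp add: V_def)
      moreover have "\<nu> x = (\<Prod>i<m. pad m k w i)" using x by (simp add: \<nu>_def prod_pad)
      moreover have "pad m k w i \<noteq> 0" if "i < m" for i
        using \<open>pad m k w \<in> V\<close> that R_nz by (auto simp: V_def)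
      ultimately show ?thesis by (auto simp: prod_zero_iff)
    qed
  qed
  finally show ?thesis .
qed

text \<open>
  Since all relations between the roots are powers of one relation, all singular terms have the
  same length and the same coefficient, so they cannot cancel.
\<close>

lemma singular_term:
  assumes "k \<le> m" "w \<in> W k" "X (- of_nat m) * \<Lambda> k w = 1"
  shows "k = m - m div l" "cf k w = (\<Prod>r\<in>R'. b r ^ (m div l))"
proof -
  let ?v = "pad m k w"
  have w: "w i \<in> R'" if "i < k" for i using assms(2) that by (auto simp: W_def)
  have v: "?v \<in> {..<m} \<rightarrow> R" using pad_in[OF assms(1,2)] by auto
  have "(\<Prod>i<m. ?v i) = 1" using assms by (simp add: prod_pad)
  then obtain q where q: "\<And>r. r \<in> R \<Longrightarrow> card {i\<in>{..<m}. ?v i = r} = q"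
    using fib_roots_tuple_relation[OF l, of ?v m] v by (auto simp: R_def)
  \<comment> \<open>Each of the \<open>l\<close> roots occurs \<open>q\<close> times in the padded
    tuple, so its length is \<open>l * q\<close>.\<close>
  have "m = (\<Sum>i<m. 1)" by simp
  also have "\<dots> = (\<Sum>r\<in>R. \<Sum>i | i \<in> {..<m} \<and> ?v i = r. 1)"
    using v by (intro sum.group[symmetric]) auto
  also have "\<dots> = (\<Sum>r\<in>R. q)" using q by (intro sum.cong) auto
  finally have "m = l * q" by (simp add: R_def card_fib_roots[OF l])
  then have q_eq: "q = m div l" using l by simp
  \<comment> \<open>The dominant root fills exactly the padding positions, so \<open>q\<close> also
    determines \<open>k\<close>.\<close>
  have "{i\<in>{..<m}. ?v i = of_real \<alpha>} = {k..<m}"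
    using w by (auto simp: pad_def R'_def not_less)
  then have "m - k = q" using q[OF alpha_in_R] by simp
  then show "k = m - m div l" using assms(1) q_eq by simp
  have "{i\<in>{..<k}. w i = r} = {i\<in>{..<m}. ?v i = r}" if "r \<in> R'" for r
    using assms(1) that by (auto simp: pad_def R'_def split: if_splits)
  then have card: "card {i\<in>{..<k}. w i = r} = q" if "r \<in> R'" for r
    using q[of r] that by (simp add: R'_def)
  have "cf k w = (\<Prod>r\<in>R'. \<Prod>i | i \<in> {..<k} \<and> w i = r. b (w i))"
    unfolding cf_def using w by (intro prod.group[symmetric]) auto
  also have "\<dots> = (\<Prod>r\<in>R'. b r ^ q)"
    using card by (intro prod.cong refl) simp
  finally show "cf k w = (\<Prod>r\<in>R'. b r ^ (m div l))" by (simp add: q_eq)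
qed

lemma b_nz: "r \<in> R' \<Longrightarrow> b r \<noteq> 0"
  using binet_coeff_nz[OF l, of r] c_pos by (auto simp: b_def R'_def R_def)

text \<open>\<open>X\<close> is an exponential function, injective on a small disc, so the zero at
  \<open>- m\<close> is isolated.\<close>

lemma filterlim_1_minus_X:
  "filterlim (\<lambda>s. 1 - X s / of_real \<alpha> ^ m) (at 0) (at (- of_nat m))"
proof -
  let ?s = "- of_nat m :: complex"
  define a where "a = ln \<alpha>"
  have a: "a > 0" using alpha_gt_1 by (simp add: a_def)
  have X: "X s = exp (- s * of_real a)" for s
    using alpha_gt_1 by (simp add: X_def powr_def a_def Ln_of_real)
  have "isCont X ?s" using analytic_X[of "{?s}"] by (rule analytic_at_imp_isCont)
  then have "(\<lambda>s. 1 - X s / of_real \<alpha> ^ m) \<midarrow>?s\<rightarrow> 1 - X ?s / of_real \<alpha> ^ m"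
    using alpha_gt_1 by (intro tendsto_intros) (auto simp: isCont_def)
  then have lim: "(\<lambda>s. 1 - X s / of_real \<alpha> ^ m) \<midarrow>?s\<rightarrow> 0"
    using alpha_gt_1 by (simp add: X_minus_nat)
  \<comment> \<open>Scaling by \<open>a\<close> maps this disc to one of radius \<open>pi\<close>,
    on which \<open>exp\<close> is injective.\<close>
  have "\<forall>\<^sub>F s in at ?s. s \<in> ball ?s (pi / a) - {?s}"
    using a by (intro eventually_at_in_open) auto
  then have "\<forall>\<^sub>F s in at ?s. 1 - X s / of_real \<alpha> ^ m \<noteq> 0"
  proof eventually_elim
    case (elim s)
    show ?case
    proof
      assume "1 - X s / of_real \<alpha> ^ m = 0"
      then have "X s = X ?s" using alpha_gt_1 by (simp add: X_minus_nat)
      then have "exp (- s * of_real a) = exp (- ?s * of_real a)" by (simp only: X)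
      moreover have "- s * of_real a \<in> ball (- ?s * of_real a) pi"
      proof -
        have "dist (- ?s * of_real a) (- s * of_real a) = norm ((s - ?s) * of_real a)"
          by (simp add: dist_norm algebra_simps)
        also have "\<dots> = dist ?s s * a" using a by (simp add: norm_mult dist_norm norm_minus_commute)
        also have "\<dots> < pi / a * a" using elim a by (intro mult_strict_right_mono) auto
        finally show ?thesis using a by simp
      qed
      ultimately have "- s * of_real a = - ?s * of_real a"
        using inj_onD[OF inj_on_exp_pi] centre_in_ball pi_gt_zero by blast
      then have "s * of_real a = ?s * of_real a" by (metis minus_mult_left neg_equal_iff_equal)
      then have "s = ?s" using mult_right_cancel[of "complex_of_real a" s ?s] a by simp
      then show False using elim by simp
    qed
  qed
  then show ?thesis using lim by (simp add: filterlim_at)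
qed

text \<open>The singular terms combine to \<open>q s * Y s / (1 - Y s)\<close> with \<open>q\<close>
  nonzero at \<open>- m\<close>, while the other terms are analytic there.\<close>

lemma singular_imp_pole:
  assumes "k0 \<le> m" "w0 \<in> W k0" "X (- of_nat m) * \<Lambda> k0 w0 = 1"
  shows "is_pole Z (- of_nat m)"
proof -
  let ?s = "- of_nat m :: complex"
  define Sg where "Sg k = {w\<in>W k. X ?s * \<Lambda> k w = 1}" for k
  define G where "G s = (\<Sum>k\<le>m. ((- s) gchoose k) *
      (\<Sum>w\<in>W k - Sg k. cf k w * (X s * \<Lambda> k w / (1 - X s * \<Lambda> k w)))) + rem_sum (Suc m) s" for s
  define q where "q s = (\<Sum>k\<le>m. ((- s) gchoose k) * (\<Sum>w\<in>Sg k. cf k w))" for s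
  define Y where "Y s = X s / of_real \<alpha> ^ m" for s
  define B where "B = (\<Prod>r\<in>R'. b r ^ (m div l))"
  \<comment> \<open>For a singular term, \<open>\<Lambda> k w\<close> is the inverse of
    \<open>\<alpha> ^ m\<close>, so all of these terms have the same dependence on
    \<open>s\<close>.\<close>
  have \<Lambda>: "X s * \<Lambda> k w = Y s" if "w \<in> Sg k" for s k w
    using that alpha_gt_1 by (simp add: Sg_def Y_def X_minus_nat field_simps)
  have H: "H k s = (\<Sum>w\<in>W k - Sg k. cf k w * (X s * \<Lambda> k w / (1 - X s * \<Lambda> k w))) +
      (\<Sum>w\<in>Sg k. cf k w) * (Y s / (1 - Y s))" for k s
  proof -
    have "H k s = (\<Sum>w\<in>W k - Sg k. cf k w * (X s * \<Lambda> k w / (1 - X s * \<Lambda> k w))) +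
       (\<Sum>w\<in>Sg k. cf k w * (X s * \<Lambda> k w / (1 - X s * \<Lambda> k w)))"
      unfolding H_def by (rule sum.subset_diff) (auto simp: Sg_def)
    then show ?thesis by (simp add: \<Lambda> sum_distrib_right sum_divide_distrib)
  qed
  have ZK: "ZK (Suc m) s = of_real c powr (- s) * (q s * Y s / (1 - Y s) + G s)" for s
    by (simp add: ZK_def H G_def q_def lessThan_Suc_atMost sum.distrib sum_distrib_right
        sum_distrib_left sum_divide_distrib algebra_simps)
  have "q ?s = (\<Sum>k\<le>m. if k = k0 then of_nat (m choose k0) * (of_nat (card (Sg k0)) * B) else 0)"
    unfolding q_def
  proof (intro sum.cong refl)
    fix k assume "k \<in> {..m}"
    then have k: "k = m - m div l" "cf k w = B" if "w \<in> Sg k" for w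
      using that singular_term[of k m w] by (auto simp: Sg_def B_def)
    have "k0 = m - m div l" using singular_term[OF assms] by simp
    then have "Sg k = {}" if "k \<noteq> k0" using k(1) that by auto
    then show "((- ?s) gchoose k) * (\<Sum>w\<in>Sg k. cf k w) =
        (if k = k0 then of_nat (m choose k0) * (of_nat (card (Sg k0)) * B) else 0)"
      using k(2) by (simp add: binomial_gbinomial)
  qed
  also have "\<dots> = of_nat (m choose k0) * (of_nat (card (Sg k0)) * B)"
    using assms(1) by simp
  also have "\<dots> \<noteq> 0"
  proof -
    have "w0 \<in> Sg k0" "finite (Sg k0)" using assms by (auto simp: Sg_def)
    then have "card (Sg k0) \<noteq> 0" by auto
    moreover have "B \<noteq> 0" using b_nz by (auto simp: B_def prod_zero_iff)
    ultimately show ?thesis using assms(1) by simp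
  qed
  finally have q0: "q ?s \<noteq> 0" .
  have q_an: "q analytic_on {?s}" unfolding q_def[abs_def] by (intro analytic_intros analytic_gbinomial)
  have Y_an: "Y analytic_on {?s}"
    unfolding Y_def[abs_def] using alpha_gt_1 by (intro analytic_intros analytic_X) auto
  have G_an: "G analytic_on {?s}"
    unfolding G_def[abs_def]
    by (intro analytic_intros analytic_gbinomial analytic_X rem_sum_analytic) (auto simp: Sg_def)
  have "is_pole (\<lambda>s. q s * Y s / (1 - Y s)) ?s"
  proof (rule is_pole_divide)
    show "isCont (\<lambda>s. q s * Y s) ?s"
      using q_an Y_an by (intro analytic_at_imp_isCont analytic_intros)
    show "filterlim (\<lambda>s. 1 - Y s) (at 0) (at ?s)" unfolding Y_def by (rule filterlim_1_minus_X)
    show "q ?s * Y ?s \<noteq> 0" using q0 alpha_gt_1 by (simp add: Y_def X_minus_nat)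
  qed
  then have "is_pole (\<lambda>s. q s * Y s / (1 - Y s) + G s) ?s"
    unfolding is_pole_def using analytic_at_imp_isCont[OF G_an]
    by (intro tendsto_add_filterlim_at_infinity') (auto simp: isCont_def)
  then have "is_pole (\<lambda>s. of_real c powr (- s) * (q s * Y s / (1 - Y s) + G s)) ?s"
    using c_pos by (intro is_pole_mult_analytic_nonzero1 analytic_c_powr) auto
  then have "is_pole (ZK (Suc m)) ?s" by (simp add: ZK[abs_def])
  moreover have "\<forall>\<^sub>F s in at ?s. Z s = ZK (Suc m) s"
    using eventually_Z_eq_ZK[of "Suc m" ?s] by (auto simp: eventually_at_filter elim: eventually_mono)
  ultimately show ?thesis using is_pole_cong[of Z "ZK (Suc m)" ?s ?s] by simp
qed

text \<open>Listing the non-dominant entries first reorders the tuple into a padded one and leaves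
  the product unchanged.\<close>

lemma tuple_eq_pad:
  assumes "v \<in> {..<m} \<rightarrow>\<^sub>E R" "(\<Prod>i<m. v i) = 1"
  shows "\<exists>k\<le>m. \<exists>w\<in>W k. X (- of_nat m) * \<Lambda> k w = 1"
proof -
  define S where "S = {i\<in>{..<m}. v i \<noteq> of_real \<alpha>}"
  define k where "k = card S"
  have S: "S \<subseteq> {..<m}" "finite S" by (auto simp: S_def)
  have k: "k \<le> m" using card_mono[OF _ S(1)] by (simp add: k_def)
  obtain h where h: "bij_betw h {..<k} S"
    using ex_bij_betw_nat_finite[OF S(2)] by (auto simp: k_def lessThan_atLeast0)
  define w where "w = restrict (\<lambda>i. v (h i)) {..<k}"
  have "h i \<in> S" if "i < k" for i using bij_betwE[OF h] that by auto
  then have w: "w \<in> W k" using assms(1) by (auto simp: W_def w_def R'_def S_def)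
  have "(\<Prod>i<k. w i) = (\<Prod>i<k. v (h i))" by (simp add: w_def)
  also have "\<dots> = (\<Prod>i\<in>S. v i)" by (rule prod.reindex_bij_betw[OF h])
  finally have wS: "(\<Prod>i<k. w i) = (\<Prod>i\<in>S. v i)" .
  have "X (- of_nat m) * \<Lambda> k w = of_real \<alpha> ^ (m - k) * (\<Prod>i<k. w i)"
    using k alpha_gt_1 by (simp add: X_minus_nat \<Lambda>_def prod_dividef power_diff)
  also have "of_real \<alpha> ^ (m - k) = (\<Prod>i\<in>{..<m} - S. v i)"
  proof -
    have "(\<Prod>i\<in>{..<m} - S. v i) = (\<Prod>i\<in>{..<m} - S. of_real \<alpha>)"
      by (intro prod.cong) (auto simp: S_def)
    then show ?thesis using S by (simp add: card_Diff_subset k_def)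
  qed
  also have "\<dots> * (\<Prod>i<k. w i) = (\<Prod>i<m. v i)"
    unfolding wS using S(1) by (subst prod.subset_diff[of S "{..<m}"]) auto
  finally show ?thesis using k w assms(2) by auto
qed

text \<open>Without a pole there are no singular terms, so \<open>Z\<close> is analytic at
  \<open>- m\<close>, keeps its value there, and no product of \<open>m\<close> roots is
  \<open>1\<close>.\<close>

lemma value_Rats:
  assumes "\<not> is_pole (gen_fib_zeta l) (- of_nat m)"
  shows "gen_fib_zeta l (- of_nat m) \<in> \<rat>"
proof -
  let ?s = "- of_nat m :: complex"
  have "isolated_singularity_at Z ?s"
    using Z_meromorphic meromorphic_on_isolated_singularity meromorphic_on_subset by blast
  then have np: "\<not> is_pole Z ?s" using assms by (simp add: gen_fib_zeta_eq)
  then have reg: "X ?s * \<Lambda> k w \<noteq> 1" if "k \<le> m" "w \<in> W k" for k w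
    using singular_imp_pole that by blast
  then have "Z analytic_on {?s}"
    by (intro Z_analytic[of "Suc m"]) auto
  then have "gen_fib_zeta l ?s = Z ?s" by (simp add: gen_fib_zeta_eq)
  also have "\<dots> \<in> \<rat>"
    using tuple_eq_pad reg by (intro regular_value_Rats) blast
  finally show ?thesis .
qed

end

theorem theorem2:
  fixes l m :: nat
  assumes "l \<ge> 2"
    and "m > 0"
    and "\<not> is_pole (gen_fib_zeta l) (- of_nat m)"
  shows "gen_fib_zeta l (- of_nat m) \<in> \<rat>"
proof -
  interpret fib_zeta l by standard (rule assms(1))
  show ?thesis using assms(3) by (rule value_Rats)
qed

end
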